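(* Let $n\ge 1$, let $b$ be a locally integrable function on $\mathbb{R}^n$ and let $0<\beta<1$. Suppose that $1<p<n/\beta$, $0<\lambda<n-\beta p$ and $1/q=1/p-\beta/(n-\lambda)$. Then $b\in\dot{\Lambda}_{\beta}(\mathbb{R}^n)$ if and only if the maximal commutator $M_b$ is bounded from $L^{p,\lambda}(\mathbb{R}^n)$ to $L^{q,\lambda}(\mathbb{R}^n)$.
   Context: For a locally integrable function $b$ on $\mathbb{R}^n$, the maximal commutator is $$M_b(f)(x)=\sup_{Q\ni x}\frac{1}{|Q|}\int_Q |b(x)-b(y)|\,|f(y)|\,dy,$$ where the supremum is over all cubes $Q\subset\mathbb{R}^n$ containing $x$ (cubes have sides parallel to the coordinate axes) and $|E|$ denotes Lebesgue measure. "Bounded from $X$ to $Y$" means that there is a constant $C$ with $\|M_b(f)\|_Y\le C\|f\|_X$ for all $f\in X$. For $0<\beta<1$, a function $b$ belongs to the Lipschitz space $\dot{\Lambda}_{\beta}(\mathbb{R}^n)$ if there is a constant $C$ such that $|b(x)-b(y)|\le C|x-y|^{\beta}$ for all $x,y\in\mathbb{R}^n$. As usual, functions are identified if they agree almost everywhere, so for a locally integrable $b$, $b\in\dot{\Lambda}_{\beta}(\mathbb{R}^n)$ means that $b$ agrees a.e. with a function satisfying this condition. For $1\le p<\infty$ and $0\le\lambda\le n$, the Morrey space is $L^{p,\lambda}(\mathbb{R}^n)=\{f\in L^p_{\mathrm{loc}}(\mathbb{R}^n):\|f\|_{L^{p,\lambda}}<\infty\}$, where $$\|f\|_{L^{p,\lambda}}=\sup_Q\bigg(\frac{1}{|Q|^{\lambda/n}}\int_Q|f(x)|^p\,dx\bigg)^{1/p},$$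 the supremum being over all cubes $Q\subset\mathbb{R}^n$. *)

theory Defs
  imports "HOL-Analysis.Analysis"
begin

text \<open>Cubes are taken closed and with positive side length; open or half-open cubes yield the same
  suprema below.\<close>

definition cubes :: "(real ^ 'n) set set" where
  "cubes = {cbox a (a + (\<chi> i. h)) | a h. 0 < h}"

definition locally_integrable :: "(real ^ 'n \<Rightarrow> real) \<Rightarrow> bool" where
  "locally_integrable f \<longleftrightarrow> (\<forall>K. compact K \<longrightarrow> set_integrable lebesgue K f)"

text \<open>Powers on \<open>[0, \<infinity>]\<close> with \<open>\<infinity> powr p = \<infinity>\<close>; only used for exponents \<open>p > 0\<close>.\<close>

definition ennpowr :: "ennreal \<Rightarrow> real \<Rightarrow> ennreal" (infixr "ennpowr" 80) where
  "x ennpowr p = (if x = \<infinity> then \<infinity> else ennreal (enn2real x powr p))"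

text \<open>The maximal commutator of a function may be infinite at some points, so it takes values
  in \<open>[0, \<infinity>]\<close>.\<close>

definition maximal_commutator ::
    "(real ^ 'n \<Rightarrow> real) \<Rightarrow> (real ^ 'n \<Rightarrow> real) \<Rightarrow> real ^ 'n \<Rightarrow> ennreal" where
  "maximal_commutator b f x =
     (SUP Q \<in> {Q \<in> cubes. x \<in> Q}.
        (\<integral>\<^sup>+ y \<in> Q. ennreal (\<bar>b x - b y\<bar> * \<bar>f y\<bar>) \<partial>lebesgue) / emeasure lebesgue Q)"

text \<open>Membership is up to equality almost everywhere.\<close>

definition lipschitz_space :: "real \<Rightarrow> (real ^ 'n \<Rightarrow> real) set" where
  "lipschitz_space \<beta> =
     {b. \<exists>g. (\<exists>C. \<forall>x y. \<bar>g x - g y\<bar> \<le> C * norm (x - y) powr \<beta>) \<and> (AE x in lebesgue. b x = g x)}"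

text \<open>The Morrey norm is a function of the modulus, given here as a function into \<open>[0, \<infinity>]\<close>, so that
  it applies both to \<open>\<bar>f\<bar>\<close> for real-valued \<open>f\<close> and to a maximal commutator.\<close>

definition morrey_norm :: "real \<Rightarrow> real \<Rightarrow> (real ^ 'n \<Rightarrow> ennreal) \<Rightarrow> ennreal" where
  "morrey_norm p lam g =
     (SUP Q \<in> cubes.
        ((\<integral>\<^sup>+ x \<in> Q. g x ennpowr p \<partial>lebesgue)
           / ennreal (measure lebesgue Q powr (lam / real CARD('n)))) ennpowr (1 / p))"

definition morrey_space :: "real \<Rightarrow> real \<Rightarrow> (real ^ 'n \<Rightarrow> real) set" where
  "morrey_space p lam =
     {f \<in> borel_measurable lebesgue.
        locally_integrable (\<lambda>x. \<bar>f x\<bar> powr p) \<and> morrey_norm p lam (\<lambda>x. ennreal \<bar>f x\<bar>) < \<infinity>}"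

text \<open>The values \<open>T f\<close> need no separate measurability clause for \<open>T = maximal_commutator b\<close>: the
  defining supremum can be restricted to cubes with rational vertices, so \<open>T f\<close> is Lebesgue
  measurable, and a finite Morrey norm then makes it finite almost everywhere and locally \<open>L\<^sup>q\<close>.\<close>

definition bounded_morrey ::
    "((real ^ 'n \<Rightarrow> real) \<Rightarrow> real ^ 'n \<Rightarrow> ennreal) \<Rightarrow> real \<Rightarrow> real \<Rightarrow> real \<Rightarrow> bool" where
  "bounded_morrey T p q lam \<longleftrightarrow>
     (\<exists>C::real. \<forall>f \<in> morrey_space p lam.
        morrey_norm q lam (T f) \<le> ennreal C * morrey_norm p lam (\<lambda>x. ennreal \<bar>f x\<bar>))"

end

theory Submission
  imports Defs
begin

text \<open>
  If \<open>b\<close> is Hoelder continuous, the average of \<open>\<bar>b x - b y\<bar> \<bar>f y\<bar>\<close> over a cube of side \<open>h\<close> is at most a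
  constant times \<open>h powr \<beta> * A\<close>, where \<open>A\<close> is the average of \<open>\<bar>f\<bar>\<close>, and the Morrey norm gives
  \<open>A \<le> 2 N h powr (- s)\<close> with \<open>s = (n - lam) / p\<close>. On a test cube of side \<open>L\<close>, cubes with \<open>h > L\<close> are
  handled by this bound alone; for \<open>h \<le> L\<close> interpolation between the two bounds gives
  \<open>h powr \<beta> * A \<le> A powr (p / q) * (2 N) powr (1 - p / q)\<close>, so the \<open>L\<^sup>p\<close> bound of the Hardy-Littlewood
  maximal function, applied to \<open>f\<close> cut off to the tripled cube, finishes the proof.

  Conversely, testing boundedness on the indicator of a cube \<open>Q\<close> shows that the mean oscillation of \<open>b\<close>
  on \<open>Q\<close> is \<open>O(h powr \<beta>)\<close>. Averages over shrinking dyadic cubes at \<open>x\<close> then converge geometrically to a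
  Hoelder function \<open>g\<close>, and \<open>\<bar>b - g\<bar>\<close> has mean \<open>O(h powr \<beta>)\<close> on every dyadic-sized cube of side \<open>h\<close>.
  Tiling by such cubes shows that its integral over any ball vanishes, so Lebesgue's differentiation
  theorem is not needed.
\<close>

section \<open>The Hardy-Littlewood maximal function\<close>

lemma sigma_finite_lebesgue: "sigma_finite_measure (lebesgue :: 'a::euclidean_space measure)"
proof -
  obtain A :: "'a set set" where "countable A" "A \<subseteq> sets lborel" "\<Union>A = space lborel"
    "\<forall>a\<in>A. emeasure lborel a \<noteq> \<infinity>"
    using lborel.sigma_finite_countable by blast
  then show ?thesis
    by (intro sigma_finite_measure.intro exI[of _ A]) (auto simp: subset_iff)
qed

text \<open>The indicator of a union is at most the sum of the indicators, and the sum can be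
  exchanged with the integral. The sum is an integral over \<open>count_space\<close> because the
  Vitali balls are indexed by a countable set of pairs instead of \<open>nat\<close>.\<close>

lemma emeasure_UN_countable_le:
  assumes [measurable]: "\<And>i. i \<in> I \<Longrightarrow> X i \<in> sets M" and "countable I"
  shows "emeasure M (\<Union>i\<in>I. X i) \<le> (\<integral>\<^sup>+ i. emeasure M (X i) \<partial>count_space I)"
proof -
  have [measurable]: "(\<Union>i\<in>I. X i) \<in> sets M"
    using assms by blast
  have "emeasure M (\<Union>i\<in>I. X i) = (\<integral>\<^sup>+ x. indicator (\<Union>i\<in>I. X i) x \<partial>M)"
    by simp
  also have "\<dots> \<le> (\<integral>\<^sup>+ x. \<integral>\<^sup>+ i. indicator (X i) x \<partial>count_space I \<partial>M)"
  proof (rule nn_integral_mono)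
    fix x
    show "indicator (\<Union>i\<in>I. X i) x \<le> (\<integral>\<^sup>+ i. indicator (X i) x \<partial>count_space I :: ennreal)"
    proof (cases "x \<in> (\<Union>i\<in>I. X i)")
      case True
      then obtain i where "i \<in> I" "x \<in> X i" by auto
      then show ?thesis
        using nn_integral_ge_point[of i I "\<lambda>i. indicator (X i) x :: ennreal"] by (auto simp: indicator_def)
    qed simp
  qed
  also have "\<dots> = (\<integral>\<^sup>+ i. \<integral>\<^sup>+ x. indicator (X i) x \<partial>M \<partial>count_space I)"
    by (rule nn_integral_count_space_nn_integral) (use assms in auto)
  also have "\<dots> = (\<integral>\<^sup>+ i. emeasure M (X i) \<partial>count_space I)"
    by (rule nn_integral_cong) simp
  finally show ?thesis .
qed

section \<open>Layer cake formula for p-th powers\<close>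

lemma nn_integral_powr_Ioo:
  fixes a c :: real
  assumes "0 < a" "0 \<le> c"
  shows "(\<integral>\<^sup>+ t. ennreal (a * t powr (a - 1)) * indicator {0<..<c} t \<partial>lborel) = ennreal (c powr a)"
proof -
  have "((\<lambda>t. t powr (a - 1)) has_integral (c powr a / a)) {0..c}"
    using has_integral_powr_from_0[of "a - 1" c] assms by simp
  then have "((\<lambda>t. a * t powr (a - 1)) has_integral (a * (c powr a / a))) {0..c}"
    by (rule has_integral_mult_right)
  then have "((\<lambda>t. a * t powr (a - 1)) has_integral (c powr a)) {0<..<c}"
    using assms by (simp add: has_integral_Icc_iff_Ioo)
  then show ?thesis
    by (intro nn_integral_has_integral_lebesgue') (use assms in auto)
qed

text \<open>The derivative of \<open>t powr p\<close> is integrated from 0 to \<open>y\<close>.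
  Writing the range of \<open>t\<close> as a condition on \<open>y\<close> lets Fubini express the
  integral of a p-th power through the measures of superlevel sets.\<close>

lemma ennpowr_layer_cake:
  fixes y :: ennreal and p :: real
  assumes "0 < p"
  shows "y ennpowr p = (\<integral>\<^sup>+ t. ennreal (p * t powr (p - 1)) * indicator {t. 0 < t \<and> ennreal t < y} t \<partial>lborel)"
    (is "_ = ?R y")
proof (cases y)
  case (real r)
  then have "{t. 0 < t \<and> ennreal t < y} = {0<..<r}"
    by (auto simp: ennreal_less_iff)
  then show ?thesis
    using real nn_integral_powr_Ioo[OF assms, of r] by (simp add: ennpowr_def)
next
  case top
  \<comment> \<open>For infinite \<open>y\<close>, the range up to \<open>K powr (1 / p)\<close>
    alone contributes \<open>K\<close>, so the integral exceeds every real number.\<close>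
  have "ennreal K \<le> ?R y" if "0 \<le> K" for K
  proof -
    have "ennreal K = ennreal ((K powr (1 / p)) powr p)"
      using assms that by (simp add: powr_powr)
    also have "\<dots> = (\<integral>\<^sup>+ t. ennreal (p * t powr (p - 1)) * indicator {0<..<K powr (1 / p)} t \<partial>lborel)"
      using assms by (intro nn_integral_powr_Ioo[symmetric]) auto
    also have "\<dots> \<le> ?R y"
      using top by (intro nn_integral_mono mult_left_mono) (auto simp: indicator_def)
    finally show ?thesis .
  qed
  then have "?R y = \<infinity>"
  proof (cases "?R y")
    case (real r)
    then show ?thesis
      using \<open>\<And>K. 0 \<le> K \<Longrightarrow> ennreal K \<le> ?R y\<close>[of "r + 1"] real(1)
      by (simp only: real(2) ennreal_le_iff) simp
  qed simp
  then show ?thesis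
    using top by (simp add: ennpowr_def)
qed

section \<open>Weak and strong type bounds\<close>

text \<open>The uncentred maximal function. Open balls make its superlevel sets open, which settles
  measurability, and they fit Vitali's covering lemma; cubes are compared with balls later.\<close>

definition maximal_function :: "('a::euclidean_space \<Rightarrow> real) \<Rightarrow> 'a \<Rightarrow> ennreal" where
  "maximal_function f x =
     (SUP B \<in> {ball c r |c r. x \<in> ball c r}.
        (\<integral>\<^sup>+ y \<in> B. ennreal \<bar>f y\<bar> \<partial>lebesgue) / emeasure lebesgue B)"

lemma superlevel_maximal_function:
  "{x. u < maximal_function f x} =
     \<Union>{ball c r |c r. u < (\<integral>\<^sup>+ y \<in> ball c r. ennreal \<bar>f y\<bar> \<partial>lebesgue) / emeasure lebesgue (ball c r)}"
  unfolding maximal_function_def less_SUP_iff by blast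

lemma open_superlevel_maximal_function: "open {x. u < maximal_function f x}"
  unfolding superlevel_maximal_function by (rule open_Union) auto

lemma borel_measurable_maximal_function [measurable]: "maximal_function f \<in> borel_measurable borel"
  by (rule borel_measurableI_greater) (simp add: borel_open open_superlevel_maximal_function)

lemma less_divide_ennreal_imp:
  fixes a b c :: ennreal
  assumes "a < b / c" "c < top"
  shows "a * c \<le> b"
proof (cases "c = 0")
  case False
  then have "b = b / c * c"
    using assms by (simp add: ennreal_divide_times ennreal_divide_self top.not_eq_extremum)
  then show ?thesis
    using assms mult_right_mono[of a "b / c" c] by simp
qed simp

lemma emeasure_lebesgue_ball:
  fixes c :: "'a::euclidean_space"
  shows "0 \<le> r \<Longrightarrow> emeasure lebesgue (ball c r) = ennreal (unit_ball_vol DIM('a) * r ^ DIM('a))"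
  by (simp add: emeasure_ball)

text \<open>Vitali's covering lemma selects disjoint balls whose fivefold dilates cover the
  superlevel set. On each selected ball \<open>t\<close> times the volume is at most the integral of
  \<open>\<bar>f\<bar>\<close>, and by disjointness these integrals add up to at most the total
  one.\<close>

lemma maximal_function_weak_type:
  fixes f :: "'a::euclidean_space \<Rightarrow> real"
  assumes [measurable]: "f \<in> borel_measurable lebesgue" and "0 < t"
  shows "ennreal t * emeasure lebesgue {x. ennreal t < maximal_function f x}
           \<le> 5 ^ DIM('a) * (\<integral>\<^sup>+ x. ennreal \<bar>f x\<bar> \<partial>lebesgue)"
proof (cases "(\<integral>\<^sup>+ x. ennreal \<bar>f x\<bar> \<partial>lebesgue)")
  case (real I)
  let ?n = "DIM('a)" and ?w = "unit_ball_vol DIM('a)"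
  define F where "F B = (\<integral>\<^sup>+ y \<in> B. ennreal \<bar>f y\<bar> \<partial>lebesgue)" for B
  define K where "K = {(c :: 'a, r :: real). 0 < r \<and> ennreal t * emeasure lebesgue (ball c r) \<le> F (ball c r)}"
  have w: "0 < ?w" by simp
  have sub: "{x. ennreal t < maximal_function f x} \<subseteq> (\<Union>i\<in>K. ball (fst i) (snd i))"
  proof
    fix x assume "x \<in> {x. ennreal t < maximal_function f x}"
    then obtain c r where x: "x \<in> ball c r"
      and "ennreal t < F (ball c r) / emeasure lebesgue (ball c r)"
      unfolding superlevel_maximal_function F_def by blast
    then have "ennreal t * emeasure lebesgue (ball c r) \<le> F (ball c r)"
      by (intro less_divide_ennreal_imp) (auto simp: emeasure_lborel_ball_finite[unfolded infinity_ennreal_def])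
    moreover have "0 < r" using x by (metis ball_eq_empty empty_iff not_le)
    ultimately show "x \<in> (\<Union>i\<in>K. ball (fst i) (snd i))"
      using x unfolding K_def by force
  qed
  \<comment> \<open>Vitali's lemma asks for uniformly bounded radii. Finiteness of the integral
    bounds \<open>r ^ ?n\<close>, which dominates \<open>r\<close> only once \<open>r\<close> is at
    least 1; hence the maximum with 1.\<close>
  have bound: "0 < snd i \<and> snd i \<le> max 1 (I / (t * ?w))" if "i \<in> K" for i
  proof -
    obtain c r where i: "i = (c, r)" by force
    with that have r: "0 < r" and le: "ennreal t * emeasure lebesgue (ball c r) \<le> F (ball c r)"
      by (auto simp: K_def)
    have "F (ball c r) \<le> ennreal I"
      unfolding F_def real(2)[symmetric] by (intro nn_integral_mono) (auto simp: indicator_def)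
    with le have "ennreal (t * (?w * r ^ ?n)) \<le> ennreal I"
      using r \<open>0 < t\<close> by (subst (asm) emeasure_lebesgue_ball) (auto simp: ennreal_mult)
    then have "t * (?w * r ^ ?n) \<le> I"
      using real by (simp add: ennreal_le_iff)
    then have "r ^ ?n \<le> I / (t * ?w)"
      using \<open>0 < t\<close> w by (simp add: field_simps)
    moreover have "r \<le> 1 \<or> r \<le> r ^ ?n"
      using self_le_power[of r ?n] by fastforce
    ultimately show ?thesis
      using r i by (auto simp: le_max_iff_disj)
  qed
  obtain C where C: "countable C" "C \<subseteq> K"
    "pairwise (\<lambda>i j. disjnt (ball (fst i) (snd i)) (ball (fst j) (snd j))) C"
    and cov: "{x. ennreal t < maximal_function f x} \<subseteq> (\<Union>i\<in>C. ball (fst i) (5 * snd i))"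
    using Vitali_covering_lemma_balls[OF sub bound] by blast
  have disj: "disjoint_family_on (\<lambda>i. ball (fst i) (snd i)) C"
    using C(3) by (auto simp: disjoint_family_on_def pairwise_def disjnt_def)
  have "ennreal t * emeasure lebesgue {x. ennreal t < maximal_function f x}
      \<le> ennreal t * emeasure lebesgue (\<Union>i\<in>C. ball (fst i) (5 * snd i))"
    using cov C(1) by (intro mult_left_mono emeasure_mono sets.countable_UN') auto
  also have "\<dots> \<le> ennreal t * (\<integral>\<^sup>+ i. emeasure lebesgue (ball (fst i) (5 * snd i)) \<partial>count_space C)"
    using C(1) by (intro mult_left_mono emeasure_UN_countable_le) auto
  also have "\<dots> = (\<integral>\<^sup>+ i. ennreal t * emeasure lebesgue (ball (fst i) (5 * snd i)) \<partial>count_space C)"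
    by (subst nn_integral_cmult) auto
  \<comment> \<open>The integral of \<open>\<bar>f\<bar>\<close> over a ball is read as the value of
    a measure, so that countable additivity applies to the disjoint balls.\<close>
  also have "\<dots> \<le> (\<integral>\<^sup>+ i. 5 ^ ?n * emeasure (density lebesgue (\<lambda>x. ennreal \<bar>f x\<bar>)) (ball (fst i) (snd i)) \<partial>count_space C)"
  proof (rule nn_integral_mono)
    fix i assume "i \<in> space (count_space C)"
    then have "i \<in> K" using C(2) by auto
    then obtain c r where i: "i = (c, r)" "0 < r" "ennreal t * emeasure lebesgue (ball c r) \<le> F (ball c r)"
      by (auto simp: K_def)
    have "emeasure lebesgue (ball c (5 * r)) = 5 ^ ?n * emeasure lebesgue (ball c r)"
      using i by (simp add: emeasure_ball power_mult_distrib ennreal_mult' ennreal_power[symmetric] mult_ac)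
    then have "ennreal t * emeasure lebesgue (ball c (5 * r)) = 5 ^ ?n * (ennreal t * emeasure lebesgue (ball c r))"
      by (simp add: mult_ac)
    also have "\<dots> \<le> 5 ^ ?n * F (ball c r)"
      by (intro mult_left_mono i) auto
    also have "F (ball c r) = emeasure (density lebesgue (\<lambda>x. ennreal \<bar>f x\<bar>)) (ball c r)"
      unfolding F_def by (subst emeasure_density) auto
    finally show "ennreal t * emeasure lebesgue (ball (fst i) (5 * snd i)) \<le> 5 ^ ?n * emeasure (density lebesgue (\<lambda>x. ennreal \<bar>f x\<bar>)) (ball (fst i) (snd i))"
      using i by simp
  qed
  also have "\<dots> = 5 ^ ?n * emeasure (density lebesgue (\<lambda>x. ennreal \<bar>f x\<bar>)) (\<Union>i\<in>C. ball (fst i) (snd i))"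
    using C(1) disj by (subst emeasure_UN_countable) (auto simp: nn_integral_cmult)
  also have "\<dots> \<le> 5 ^ ?n * emeasure (density lebesgue (\<lambda>x. ennreal \<bar>f x\<bar>)) UNIV"
    by (intro mult_left_mono emeasure_mono) auto
  also have "\<dots> = 5 ^ ?n * (\<integral>\<^sup>+ x. ennreal \<bar>f x\<bar> \<partial>lebesgue)"
    by (subst emeasure_density) auto
  finally show ?thesis .
qed (simp add: ennreal_mult_top)

text \<open>The values of \<open>\<bar>f\<bar>\<close> up to \<open>s\<close> add at most
  \<open>s\<close> to any average. This lets the weak type bound at height \<open>t\<close> see only
  the part of \<open>f\<close> above \<open>t / 2\<close>.\<close>

lemma maximal_function_truncate:
  fixes f :: "'a::euclidean_space \<Rightarrow> real"
  assumes [measurable]: "f \<in> borel_measurable lebesgue" and "0 \<le> s"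
  shows "maximal_function f x \<le> maximal_function (\<lambda>y. if s < \<bar>f y\<bar> then f y else 0) x + ennreal s"
  unfolding maximal_function_def[of f]
proof (rule SUP_least)
  let ?g = "\<lambda>y. if s < \<bar>f y\<bar> then f y else 0"
  fix B assume B: "B \<in> {ball c r |c r. x \<in> ball c r}"
  then have [measurable]: "B \<in> sets lebesgue" by auto
  obtain c r where Bc: "B = ball c r" "0 < r" using B by (auto dest: le_less_trans[OF zero_le_dist])
  have pos: "emeasure lebesgue B \<noteq> 0" "emeasure lebesgue B \<noteq> top"
    using Bc unit_ball_vol_pos[of "real DIM('a)"]
    by (auto simp: emeasure_ball less_le)
  have "(\<integral>\<^sup>+ y \<in> B. ennreal \<bar>f y\<bar> \<partial>lebesgue) \<le> (\<integral>\<^sup>+ y. ennreal \<bar>?g y\<bar> * indicator B y + ennreal s * indicator B y \<partial>lebesgue)"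
    by (intro nn_integral_mono) (auto simp: indicator_def not_less intro!: ennreal_leI)
  also have "\<dots> = (\<integral>\<^sup>+ y \<in> B. ennreal \<bar>?g y\<bar> \<partial>lebesgue) + ennreal s * emeasure lebesgue B"
    by (subst nn_integral_add) (auto simp: nn_integral_cmult_indicator)
  finally have "(\<integral>\<^sup>+ y \<in> B. ennreal \<bar>f y\<bar> \<partial>lebesgue) / emeasure lebesgue B
      \<le> ((\<integral>\<^sup>+ y \<in> B. ennreal \<bar>?g y\<bar> \<partial>lebesgue) + ennreal s * emeasure lebesgue B) / emeasure lebesgue B"
    by (rule divide_right_mono_ennreal)
  also have "\<dots> = (\<integral>\<^sup>+ y \<in> B. ennreal \<bar>?g y\<bar> \<partial>lebesgue) / emeasure lebesgue B + ennreal s"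
    using pos by (simp add: add_divide_distrib_ennreal ennreal_mult_divide_eq)
  also have "\<dots> \<le> maximal_function ?g x + ennreal s"
    unfolding maximal_function_def using B by (intro add_right_mono SUP_upper) auto
  finally show "(\<integral>\<^sup>+ y \<in> B. ennreal \<bar>f y\<bar> \<partial>lebesgue) / emeasure lebesgue B \<le> maximal_function ?g x + ennreal s" .
qed

text \<open>Marcinkiewicz interpolation: at each height \<open>t\<close> the weak type bound is
  applied to the part of \<open>f\<close> above \<open>t / 2\<close>, and the results are integrated
  over \<open>t\<close> by the layer cake formula.\<close>

lemma maximal_function_strong_type:
  fixes f :: "'a::euclidean_space \<Rightarrow> real"
  assumes [measurable]: "f \<in> borel_measurable lebesgue" and p: "1 < p"
  shows "(\<integral>\<^sup>+ x. maximal_function f x ennpowr p \<partial>lebesgue)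
           \<le> ennreal (2 powr p * 5 ^ DIM('a) * p / (p - 1)) * (\<integral>\<^sup>+ x. ennreal (\<bar>f x\<bar> powr p) \<partial>lebesgue)"
proof -
  let ?M = "maximal_function f"
  interpret L: sigma_finite_measure "lebesgue :: 'a measure"
    by (rule sigma_finite_lebesgue)
  interpret P: pair_sigma_finite "lebesgue :: 'a measure" "lborel :: real measure"
    by unfold_locales
  have [measurable]: "?M \<in> borel_measurable lebesgue"
    using borel_measurable_maximal_function by (metis measurable_completion measurable_lborel2)
  \<comment> \<open>The factor 2 comes from using height \<open>t / 2\<close>, the power of 5 from
    Vitali. Dividing by \<open>p - 1\<close> normalises the integrand in \<open>t\<close>, which
    then integrates to \<open>(2 * \<bar>f x\<bar>) powr (p - 1)\<close>.\<close>
  define c where "c = 2 * 5 ^ DIM('a) * p / (p - 1)"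
  have c: "0 \<le> c" using p by (simp add: c_def)
  have factor: "c * (p - 1) = 2 * (p * 5 ^ DIM('a))"
    using p by (simp add: c_def)
  have "(\<integral>\<^sup>+ x. ?M x ennpowr p \<partial>lebesgue) =
      (\<integral>\<^sup>+ x. \<integral>\<^sup>+ t. ennreal (p * t powr (p - 1)) * indicator {t. 0 < t \<and> ennreal t < ?M x} t \<partial>lborel \<partial>lebesgue)"
    using p by (intro nn_integral_cong ennpowr_layer_cake) auto
  also have "\<dots> = (\<integral>\<^sup>+ t. \<integral>\<^sup>+ x. ennreal (p * t powr (p - 1)) * indicator {t. 0 < t \<and> ennreal t < ?M x} t \<partial>lebesgue \<partial>lborel)"
    by (rule P.Fubini'[symmetric]) (unfold indicator_def, measurable)
  also have "\<dots> \<le> (\<integral>\<^sup>+ t. \<integral>\<^sup>+ x. ennreal (c * \<bar>f x\<bar>) * (ennreal ((p - 1) * t powr (p - 1 - 1)) * indicator {0<..<2 * \<bar>f x\<bar>} t) \<partial>lebesgue \<partial>lborel)"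
  proof (rule nn_integral_mono)
    fix t :: real
    show "(\<integral>\<^sup>+ x. ennreal (p * t powr (p - 1)) * indicator {t. 0 < t \<and> ennreal t < ?M x} t \<partial>lebesgue)
      \<le> (\<integral>\<^sup>+ x. ennreal (c * \<bar>f x\<bar>) * (ennreal ((p - 1) * t powr (p - 1 - 1)) * indicator {0<..<2 * \<bar>f x\<bar>} t) \<partial>lebesgue)"
    proof (cases "0 < t")
      case True
      \<comment> \<open>One factor \<open>t / 2\<close> is split off to be the height in the weak
        type inequality.\<close>
      have split: "ennreal (p * t powr (p - 1)) = ennreal (2 * p * t powr (p - 2)) * ennreal (t / 2)"
        using True p by (subst ennreal_mult[symmetric]) (auto simp: powr_diff power2_eq_square)
      define g where "g y = (if t / 2 < \<bar>f y\<bar> then f y else 0)" for y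
      have [measurable]: "g \<in> borel_measurable lebesgue"
        unfolding g_def by measurable
      have sub: "{x. ennreal t < ?M x} \<subseteq> {x. ennreal (t / 2) < maximal_function g x}"
      proof clarify
        fix x assume t: "ennreal t < ?M x"
        show "ennreal (t / 2) < maximal_function g x"
        proof (rule ccontr)
          assume "\<not> ennreal (t / 2) < maximal_function g x"
          then have "maximal_function g x + ennreal (t / 2) \<le> ennreal (t / 2) + ennreal (t / 2)"
            by (intro add_right_mono) (simp add: not_less)
          also have "\<dots> = ennreal t"
            using True by (subst ennreal_plus[symmetric]) auto
          finally show False
            using maximal_function_truncate[of f "t / 2" x] t True by (simp add: g_def[abs_def])
        qed
      qed
      have "(\<integral>\<^sup>+ x. ennreal (p * t powr (p - 1)) * indicator {t. 0 < t \<and> ennreal t < ?M x} t \<partial>lebesgue)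
        = (\<integral>\<^sup>+ x. ennreal (p * t powr (p - 1)) * indicator {x. ennreal t < ?M x} x \<partial>lebesgue)"
        using True by (intro nn_integral_cong) (auto simp: indicator_def)
      also have "\<dots> = ennreal (p * t powr (p - 1)) * emeasure lebesgue {x. ennreal t < ?M x}"
        by (rule nn_integral_cmult_indicator) (simp add: borel_open open_superlevel_maximal_function)
      also have "\<dots> \<le> ennreal (p * t powr (p - 1)) * emeasure lebesgue {x. ennreal (t / 2) < maximal_function g x}"
        by (intro mult_left_mono emeasure_mono sub) (auto simp: borel_open open_superlevel_maximal_function)
      also have "\<dots> = ennreal (2 * p * t powr (p - 2)) * (ennreal (t / 2) * emeasure lebesgue {x. ennreal (t / 2) < maximal_function g x})"
        by (simp only: split mult.assoc)
      also have "\<dots> \<le> ennreal (2 * p * t powr (p - 2)) * (5 ^ DIM('a) * (\<integral>\<^sup>+ x. ennreal \<bar>g x\<bar> \<partial>lebesgue))"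
        using True by (intro mult_left_mono maximal_function_weak_type) auto
      also have "\<dots> = ennreal (2 * p * t powr (p - 2) * 5 ^ DIM('a)) * (\<integral>\<^sup>+ x. ennreal \<bar>g x\<bar> \<partial>lebesgue)"
        using p by (simp add: ennreal_mult ennreal_power[symmetric] mult.assoc)
      also have "\<dots> = (\<integral>\<^sup>+ x. ennreal (2 * p * t powr (p - 2) * 5 ^ DIM('a)) * ennreal \<bar>g x\<bar> \<partial>lebesgue)"
        by (subst nn_integral_cmult) auto
      also have "\<dots> = (\<integral>\<^sup>+ x. ennreal (c * \<bar>f x\<bar>) * (ennreal ((p - 1) * t powr (p - 1 - 1)) * indicator {0<..<2 * \<bar>f x\<bar>} t) \<partial>lebesgue)"
        using True p c
        by (intro nn_integral_cong) (auto simp: g_def indicator_def ennreal_mult[symmetric] factor)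
      finally show ?thesis by simp
    qed simp
  qed
  \<comment> \<open>After the second exchange the truncation of \<open>f\<close> at
    \<open>t / 2\<close> has become, for fixed \<open>x\<close>, the range of \<open>t\<close> below
    \<open>2 * \<bar>f x\<bar>\<close>.\<close>
  also have "\<dots> = (\<integral>\<^sup>+ x. \<integral>\<^sup>+ t. ennreal (c * \<bar>f x\<bar>) * (ennreal ((p - 1) * t powr (p - 1 - 1)) * indicator {0<..<2 * \<bar>f x\<bar>} t) \<partial>lborel \<partial>lebesgue)"
    by (rule P.Fubini') (unfold indicator_def greaterThanLessThan_iff, measurable)
  also have "\<dots> = (\<integral>\<^sup>+ x. ennreal (c * \<bar>f x\<bar>) * ennreal ((2 * \<bar>f x\<bar>) powr (p - 1)) \<partial>lebesgue)"
    using p by (intro nn_integral_cong, subst nn_integral_cmult, simp, subst nn_integral_powr_Ioo) auto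
  also have "\<dots> = (\<integral>\<^sup>+ x. ennreal (2 powr p * 5 ^ DIM('a) * p / (p - 1)) * ennreal (\<bar>f x\<bar> powr p) \<partial>lebesgue)"
    using p c
    by (intro nn_integral_cong, subst (1 2) ennreal_mult[symmetric])
       (auto simp: c_def powr_mult powr_diff field_simps)
  also have "\<dots> = ennreal (2 powr p * 5 ^ DIM('a) * p / (p - 1)) * (\<integral>\<^sup>+ x. ennreal (\<bar>f x\<bar> powr p) \<partial>lebesgue)"
    by (subst nn_integral_cmult) auto
  finally show ?thesis .
qed

section \<open>Cubes and Morrey norms\<close>

lemma ennpowr_ennreal: "0 \<le> x \<Longrightarrow> ennreal x ennpowr p = ennreal (x powr p)"
  by (simp add: ennpowr_def)

lemma ennpowr_mono:
  assumes "x \<le> y" "0 \<le> p"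
  shows "x ennpowr p \<le> y ennpowr p"
proof (cases "y = \<infinity>")
  case False
  then have "x \<noteq> \<infinity>" using assms top.extremum_uniqueI by auto
  then show ?thesis
    using False assms
    by (auto simp: ennpowr_def intro!: ennreal_leI powr_mono2 enn2real_mono simp: top.not_eq_extremum)
qed (simp add: ennpowr_def)

lemma ennpowr_ennpowr: "(x ennpowr p) ennpowr q = x ennpowr (p * q)"
  by (auto simp: ennpowr_def powr_powr)

lemma ennpowr_one: "x ennpowr 1 = x"
  by (cases x) (auto simp: ennpowr_def)

lemma ennpowr_le_iff:
  assumes "0 < p"
  shows "x ennpowr p \<le> y \<longleftrightarrow> x \<le> y ennpowr (1 / p)"
  using ennpowr_mono[of "x ennpowr p" y "1 / p"] ennpowr_mono[of x "y ennpowr (1 / p)" p] assms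
  by (auto simp: ennpowr_ennpowr ennpowr_one)

section \<open>Volume and diameter of cubes\<close>

abbreviation cube :: "real ^ 'n \<Rightarrow> real \<Rightarrow> (real ^ 'n) set" where
  "cube a h \<equiv> cbox a (a + (\<chi> i. h))"

lemma mem_cube: "x \<in> cube a h \<longleftrightarrow> (\<forall>i. a $ i \<le> x $ i \<and> x $ i \<le> a $ i + h)"
  by (simp add: mem_box_cart)

lemma measure_cube:
  fixes a :: "real ^ 'n"
  assumes "0 \<le> h"
  shows "measure lebesgue (cube a h) = h ^ CARD('n)"
proof -
  have "cube a h \<noteq> {}" using assms by (auto simp: interval_ne_empty_cart)
  then show ?thesis by (simp add: content_cbox_cart)
qed

lemma emeasure_cube:
  fixes a :: "real ^ 'n"
  assumes "0 \<le> h"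
  shows "emeasure lebesgue (cube a h) = ennreal (h ^ CARD('n))"
proof -
  have fin: "emeasure lebesgue (cube a h) \<noteq> top"
    using emeasure_lborel_cbox_finite[of a] by (simp add: top.not_eq_extremum)
  show ?thesis
    using emeasure_eq_ennreal_measure[OF fin] by (simp only: measure_cube[OF assms])
qed

lemma norm_diff_le_cube:
  fixes a :: "real ^ 'n"
  assumes "x \<in> cube a h" "y \<in> cube a h"
  shows "norm (x - y) \<le> real CARD('n) * h"
proof -
  have "norm (x - y) \<le> (\<Sum>i\<in>UNIV. \<bar>(x - y) $ i\<bar>)"
    by (rule norm_le_l1_cart)
  also have "\<dots> \<le> (\<Sum>i\<in>(UNIV :: 'n set). h)"
  proof (rule sum_mono)
    fix i show "\<bar>(x - y) $ i\<bar> \<le> h"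
      using assms unfolding mem_cube vector_minus_component abs_le_iff
      by (metis add.commute add_le_cancel_left diff_le_eq le_diff_eq minus_diff_eq order_trans add_mono)
  qed
  finally show ?thesis by simp
qed

lemma divide_le_ennreal_iff:
  fixes x y :: ennreal
  assumes "0 < c"
  shows "x / ennreal c \<le> y \<longleftrightarrow> x \<le> y * ennreal c"
proof
  assume "x / ennreal c \<le> y"
  then have "x / ennreal c * ennreal c \<le> y * ennreal c"
    by (rule mult_right_mono) simp
  then show "x \<le> y * ennreal c"
    using assms by (simp add: ennreal_divide_times ennreal_divide_self)
next
  assume "x \<le> y * ennreal c"
  then have "x / ennreal c \<le> y * ennreal c / ennreal c"
    by (rule divide_right_mono_ennreal)
  then show "x / ennreal c \<le> y"
    using assms by (simp add: ennreal_mult_divide_eq)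
qed

section \<open>Morrey bounds cube by cube\<close>

text \<open>The volume of a cube is the n-th power of its side, so the weight is
  \<open>h powr lam\<close>; root and quotient are then cleared. All later arguments pass between
  norms and integrals over cubes in this form.\<close>

lemma morrey_norm_le_iff:
  fixes u :: "real ^ 'n \<Rightarrow> ennreal"
  assumes "0 < p" "0 \<le> K"
  shows "morrey_norm p lam u \<le> ennreal K \<longleftrightarrow>
    (\<forall>a h. 0 < h \<longrightarrow> (\<integral>\<^sup>+ x \<in> cube a h. u x ennpowr p \<partial>lebesgue) \<le> ennreal (K powr p * h powr lam))"
proof -
  have "((I / ennreal (measure lebesgue (cube a h) powr (lam / real CARD('n)))) ennpowr (1 / p) \<le> ennreal K)
      \<longleftrightarrow> I \<le> ennreal (K powr p * h powr lam)" if "0 < h" for I h and a :: "real ^ 'n"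
  proof -
    have "measure lebesgue (cube a h) powr (lam / real CARD('n)) = h powr lam"
      using that by (simp only: measure_cube less_imp_le) (simp add: powr_realpow[symmetric] powr_powr)
    then show ?thesis
      using assms that by (simp add: ennpowr_le_iff ennpowr_ennreal divide_le_ennreal_iff ennreal_mult)
  qed
  then show ?thesis
    unfolding morrey_norm_def cubes_def SUP_le_iff by blast
qed

text \<open>A substitute for Hoelder's inequality: \<open>\<bar>f\<bar> \<le> K + \<bar>f\<bar> powr p / K powr (p - 1)\<close>.\<close>

lemma set_nn_integral_le_of_powr:
  fixes f :: "'a \<Rightarrow> real"
  assumes [measurable]: "f \<in> borel_measurable M" "E \<in> sets M"
    and p: "1 < p" and K: "0 \<le> K" and m: "0 \<le> m" "emeasure M E = ennreal m"
    and le: "(\<integral>\<^sup>+ x \<in> E. ennreal (\<bar>f x\<bar> powr p) \<partial>M) \<le> ennreal (K powr p * m)"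
  shows "(\<integral>\<^sup>+ x \<in> E. ennreal \<bar>f x\<bar> \<partial>M) \<le> ennreal (2 * K * m)"
\<comment> \<open>For \<open>K = 0\<close> the factor \<open>K powr (1 - p)\<close> has the default
  value 0 and the pointwise bound fails; instead \<open>f\<close> vanishes almost everywhere on
  \<open>E\<close>.\<close>
proof (cases "K = 0")
  case True
  with le p have "(\<integral>\<^sup>+ x \<in> E. ennreal (\<bar>f x\<bar> powr p) \<partial>M) = 0" by simp
  then have "AE x in M. ennreal (\<bar>f x\<bar> powr p) * indicator E x = 0"
    by (subst (asm) nn_integral_0_iff_AE) auto
  then have "AE x in M. ennreal \<bar>f x\<bar> * indicator E x = 0"
    by eventually_elim (auto simp: indicator_def)
  then have "(\<integral>\<^sup>+ x \<in> E. ennreal \<bar>f x\<bar> \<partial>M) = 0"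
    by (subst nn_integral_0_iff_AE) auto
  then show ?thesis by simp
next
  case False
  with K have K: "0 < K" by simp
  have pt: "\<bar>y\<bar> \<le> K + K powr (1 - p) * \<bar>y\<bar> powr p" for y
  proof (cases "\<bar>y\<bar> \<le> K")
    case False
    then have "1 \<le> (\<bar>y\<bar> / K) powr (p - 1)"
      using K p by (intro ge_one_powr_ge_zero) auto
    then have "\<bar>y\<bar> * 1 \<le> \<bar>y\<bar> * (\<bar>y\<bar> / K) powr (p - 1)"
      by (intro mult_left_mono) auto
    also have "\<dots> = K powr (1 - p) * \<bar>y\<bar> powr p"
      using False K by (simp add: powr_divide powr_diff field_simps)
    finally show ?thesis using K by simp
  qed (use K in \<open>simp add: add_increasing2\<close>)
  have "(\<integral>\<^sup>+ x \<in> E. ennreal \<bar>f x\<bar> \<partial>M)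
      \<le> (\<integral>\<^sup>+ x. ennreal K * indicator E x + ennreal (K powr (1 - p)) * (ennreal (\<bar>f x\<bar> powr p) * indicator E x) \<partial>M)"
    using pt K
    by (intro nn_integral_mono)
       (auto simp: indicator_def ennreal_mult[symmetric] ennreal_plus[symmetric] simp del: ennreal_plus intro!: ennreal_leI)
  also have "\<dots> = ennreal K * ennreal m + ennreal (K powr (1 - p)) * (\<integral>\<^sup>+ x \<in> E. ennreal (\<bar>f x\<bar> powr p) \<partial>M)"
    by (subst nn_integral_add) (auto simp: nn_integral_cmult nn_integral_cmult_indicator m)
  also have "\<dots> \<le> ennreal K * ennreal m + ennreal (K powr (1 - p)) * ennreal (K powr p * m)"
    by (intro add_left_mono mult_left_mono le) auto
  also have "\<dots> = ennreal (K * m + K powr (1 - p) * (K powr p * m))"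
    using K m by (simp add: ennreal_mult ennreal_plus)
  \<comment> \<open>Both terms equal \<open>K * m\<close>, which is where the factor 2 comes
    from.\<close>
  also have "K * m + K powr (1 - p) * (K powr p * m) = 2 * K * m"
    using K by (simp add: mult.assoc[symmetric] powr_add[symmetric])
  finally show ?thesis .
qed

lemma morrey_space_cube_bound:
  fixes f :: "real ^ 'n \<Rightarrow> real"
  assumes f: "f \<in> morrey_space p lam" and p: "1 < p" and h: "0 < h"
  defines "N \<equiv> enn2real (morrey_norm p lam (\<lambda>x. ennreal \<bar>f x\<bar>))"
  shows "(\<integral>\<^sup>+ x \<in> cube a h. ennreal (\<bar>f x\<bar> powr p) \<partial>lebesgue) \<le> ennreal (N powr p * h powr lam)"
    and "(\<integral>\<^sup>+ x \<in> cube a h. ennreal \<bar>f x\<bar> \<partial>lebesgue)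
           \<le> ennreal (2 * N * h powr ((lam - real CARD('n)) / p) * h ^ CARD('n))"
proof -
  have "morrey_norm p lam (\<lambda>x. ennreal \<bar>f x\<bar>) \<le> ennreal N" "0 \<le> N"
    using f by (auto simp: morrey_space_def N_def)
  then show 1: "(\<integral>\<^sup>+ x \<in> cube a h. ennreal (\<bar>f x\<bar> powr p) \<partial>lebesgue) \<le> ennreal (N powr p * h powr lam)"
    using p h by (subst (asm) morrey_norm_le_iff) (auto simp: ennpowr_ennreal)
  \<comment> \<open>This is the level \<open>K\<close> at which the Morrey bound takes the form
    \<open>K powr p\<close> times the volume of the cube.\<close>
  have "N powr p * h powr lam = (N * h powr ((lam - real CARD('n)) / p)) powr p * h ^ CARD('n)"
    using h p by (simp add: powr_mult powr_powr powr_realpow[symmetric] powr_add[symmetric])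
  then have "(\<integral>\<^sup>+ x \<in> cube a h. ennreal \<bar>f x\<bar> \<partial>lebesgue)
           \<le> ennreal (2 * (N * h powr ((lam - real CARD('n)) / p)) * h ^ CARD('n))"
    using 1 f h \<open>0 \<le> N\<close>
    by (intro set_nn_integral_le_of_powr[OF _ _ p _ _ emeasure_cube]) (auto simp: morrey_space_def)
  then show "(\<integral>\<^sup>+ x \<in> cube a h. ennreal \<bar>f x\<bar> \<partial>lebesgue)
           \<le> ennreal (2 * N * h powr ((lam - real CARD('n)) / p) * h ^ CARD('n))"
    by (simp add: mult.assoc)
qed

section \<open>Maximal commutators of Hoelder functions\<close>

lemma cube_average_le_maximal_function:
  fixes f :: "real ^ 'n \<Rightarrow> real"
  assumes x: "x \<in> cube a h" and h: "0 < h" and I: "0 \<le> I"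
    and "(\<integral>\<^sup>+ y \<in> cube a h. ennreal \<bar>f y\<bar> \<partial>lebesgue) = ennreal I"
  defines "\<kappa> \<equiv> unit_ball_vol (real CARD('n)) * (real CARD('n) + 1) ^ CARD('n)"
  shows "ennreal (I / (\<kappa> * h ^ CARD('n))) \<le> maximal_function f x"
proof -
  \<comment> \<open>Points of the cube are within \<open>real CARD('n) * h\<close> of
    \<open>x\<close>; one more \<open>h\<close> puts the closed cube inside an open ball. The volume
    of this ball is \<open>\<kappa>\<close> times that of the cube.\<close>
  define B where "B = ball x ((real CARD('n) + 1) * h)"
  have \<kappa>: "0 < \<kappa>" by (simp add: \<kappa>_def)
  have "cube a h \<subseteq> B"
  proof
    fix y assume "y \<in> cube a h"
    with norm_diff_le_cube[OF x this] h show "y \<in> B"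
      by (simp add: B_def dist_norm algebra_simps)
  qed
  then have "ennreal I \<le> (\<integral>\<^sup>+ y \<in> B. ennreal \<bar>f y\<bar> \<partial>lebesgue)"
    unfolding assms(4)[symmetric] by (intro nn_integral_mono) (auto simp: indicator_def)
  moreover have "emeasure lebesgue B = ennreal (\<kappa> * h ^ CARD('n))"
    unfolding B_def using h by (subst emeasure_lebesgue_ball) (auto simp: \<kappa>_def power_mult_distrib)
  ultimately have "ennreal I / ennreal (\<kappa> * h ^ CARD('n)) \<le> (\<integral>\<^sup>+ y \<in> B. ennreal \<bar>f y\<bar> \<partial>lebesgue) / emeasure lebesgue B"
    by (simp add: divide_right_mono_ennreal)
  also have "\<dots> \<le> maximal_function f x"
  proof -
    have "x \<in> ball x ((real CARD('n) + 1) * h)" using h by simp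
    then show ?thesis
      unfolding maximal_function_def B_def by (intro SUP_upper) blast
  qed
  finally show ?thesis
    using \<kappa> h I by (simp add: divide_ennreal)
qed

text \<open>Interpolation between the two bounds \<open>A\<close> and \<open>W h powr (- s)\<close> for an average, which turns the fractional
  maximal function into a power of the Hardy-Littlewood maximal function.\<close>

lemma fractional_average_le:
  fixes A W h s \<beta> p q :: real
  assumes "0 \<le> A" "0 \<le> W" "0 < h" "p \<le> q" "s * (q - p) = \<beta> * q" "A \<le> W * h powr (- s)"
  shows "(h powr \<beta> * A) powr q \<le> A powr p * W powr (q - p)"
proof -
  have "(h powr \<beta> * A) powr q = h powr (\<beta> * q) * (A powr p * A powr (q - p))"
    using assms by (simp add: powr_mult powr_powr powr_add[symmetric])
  also have "\<dots> \<le> h powr (\<beta> * q) * (A powr p * (W * h powr (- s)) powr (q - p))"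
    using assms by (intro mult_left_mono powr_mono2) auto
  \<comment> \<open>By \<open>s * (q - p) = \<beta> * q\<close> this power of \<open>h\<close> is
    the inverse of the one in front, so the side length cancels.\<close>
  also have "(W * h powr (- s)) powr (q - p) = W powr (q - p) * h powr (- (\<beta> * q))"
    using assms by (simp add: powr_mult powr_powr)
  also have "h powr (\<beta> * q) * (A powr p * (W powr (q - p) * h powr (- (\<beta> * q)))) = A powr p * W powr (q - p)"
    using assms by (simp add: powr_minus)
  finally show ?thesis .
qed

text \<open>The bound on \<open>lam\<close> says that the subtracted
  \<open>\<beta> / (n - lam)\<close> is positive and less than \<open>1 / p\<close>. So
  \<open>1 / q\<close> lies strictly between 0 and \<open>1 / p\<close>.\<close>

lemma sobolev_exponent:
  fixes n \<beta> p q lam :: real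
  assumes "0 < \<beta>" "1 < p" "lam < n - \<beta> * p" and q: "1 / q = 1 / p - \<beta> / (n - lam)"
  shows "lam < n" and "p < q"
proof -
  have "0 < \<beta> * p" using assms by simp
  then show nl: "lam < n" using assms by linarith
  have "\<beta> / (n - lam) < 1 / p"
    using nl assms by (simp add: pos_divide_less_eq pos_less_divide_eq)
  then have "0 < 1 / q"
    using q by simp
  then have "0 < q" by simp
  moreover have "1 / q < 1 / p" using q nl assms by simp
  ultimately show "p < q"
    using inverse_less_imp_less[of q p] by (simp add: inverse_eq_divide)
qed

section \<open>Hoelder regularity implies boundedness\<close>

lemma lipschitz_maximal_commutator_bounded:
  fixes b :: "real ^ 'n \<Rightarrow> real" and \<beta> p q lam :: real
  assumes \<beta>: "0 < \<beta>" and p: "1 < p" and lam: "lam < real CARD('n) - \<beta> * p"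
    and q: "1 / q = 1 / p - \<beta> / (real CARD('n) - lam)"
    and b: "b \<in> lipschitz_space \<beta>"
  shows "bounded_morrey (maximal_commutator b) p q lam"
proof -
  let ?n = "real CARD('n)"
  obtain g C0 where g: "\<And>x y. \<bar>g x - g y\<bar> \<le> C0 * norm (x - y) powr \<beta>" and bg: "AE x in lebesgue. b x = g x"
    using b by (auto simp: lipschitz_space_def)
  define s where "s = (?n - lam) / p"
  note exps = sobolev_exponent[OF \<beta> p lam q]
  have nl: "0 < ?n - lam" and pq: "p < q" and q0: "0 < q"
    using exps p by auto
  \<comment> \<open>The first identity drives the interpolation on small cubes; the second gives the
    power of the side length left over on large ones.\<close>
  have sq: "s * (q - p) = \<beta> * q" and sb: "(\<beta> - s) * q = lam - ?n"
    using q q0 p nl unfolding s_def by (simp_all add: field_simps)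
  define D where "D = \<bar>C0\<bar> * ?n powr \<beta>"
  have D: "0 \<le> D" by (simp add: D_def)
  define \<kappa> where "\<kappa> = unit_ball_vol ?n * (?n + 1) ^ CARD('n)"
  have \<kappa>: "0 < \<kappa>" by (simp add: \<kappa>_def)
  define Kp where "Kp = 2 powr p * 5 ^ CARD('n) * p / (p - 1)"
  have Kp: "0 \<le> Kp" using p by (simp add: Kp_def)
  \<comment> \<open>The first summand comes from small cubes, with \<open>3 powr lam\<close> due to
    the tripled test cube, and the second from large cubes. The outer root undoes the q-th
    power.\<close>
  define C where "C = (D powr q * \<kappa> powr p * 2 powr (q - p) * Kp * 3 powr lam + D powr q * 2 powr q) powr (1 / q)"
  have "morrey_norm q lam (maximal_commutator b f) \<le> ennreal C * morrey_norm p lam (\<lambda>x. ennreal \<bar>f x\<bar>)"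
    if f: "f \<in> morrey_space p lam" for f
  proof -
    have [measurable]: "f \<in> borel_measurable lebesgue" using f by (simp add: morrey_space_def)
    define N where "N = enn2real (morrey_norm p lam (\<lambda>x. ennreal \<bar>f x\<bar>))"
    have N: "0 \<le> N" "morrey_norm p lam (\<lambda>x. ennreal \<bar>f x\<bar>) = ennreal N"
      using f by (auto simp: morrey_space_def N_def)
    note fp = morrey_space_cube_bound(1)[OF f p, folded N_def]
    note f1 = morrey_space_cube_bound(2)[OF f p, folded N_def]
    have "(\<integral>\<^sup>+ x \<in> cube c L. maximal_commutator b f x ennpowr q \<partial>lebesgue) \<le> ennreal ((C * N) powr q * L powr lam)"
      if L: "0 < L" for c L
    proof -
      \<comment> \<open>Every cube of side at most \<open>L\<close> that meets
        \<open>cube c L\<close> lies in \<open>Q3\<close>, so small cubes cannot distinguish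
        \<open>F\<close> from \<open>f\<close>.\<close>
      define Q3 where "Q3 = cube (c - (\<chi> i. L)) (3 * L)"
      define F where "F y = f y * indicator Q3 y" for y
      have [measurable]: "Q3 \<in> sets lebesgue" by (simp add: Q3_def)
      have [measurable]: "F \<in> borel_measurable lebesgue" unfolding F_def by measurable
      have [measurable]: "maximal_function F \<in> borel_measurable lebesgue"
        using borel_measurable_maximal_function by (metis measurable_completion measurable_lborel2)
      define c1 where "c1 = D powr q * \<kappa> powr p * (2 * N) powr (q - p)"
      define c2 where "c2 = D powr q * ((2 * N) powr q * L powr (lam - ?n))"
      have c12: "0 \<le> c1" "0 \<le> c2" by (auto simp: c1_def c2_def)
      \<comment> \<open>Here \<open>c1\<close> belongs to the small cubes and \<open>c2\<close> to
        the large ones. Points with \<open>b x \<noteq> g x\<close> form a null set, which the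
        integration below ignores.\<close>
      have pt: "maximal_commutator b f x ennpowr q \<le> ennreal c1 * (maximal_function F x ennpowr p) + ennreal c2"
        if x: "b x = g x" "x \<in> cube c L" for x
      proof -
        have "(\<integral>\<^sup>+ y \<in> Q. ennreal (\<bar>b x - b y\<bar> * \<bar>f y\<bar>) \<partial>lebesgue) / emeasure lebesgue Q
            \<le> (ennreal c1 * (maximal_function F x ennpowr p) + ennreal c2) ennpowr (1 / q)"
          if Q: "Q \<in> {Q \<in> cubes. x \<in> Q}" for Q
        proof -
          obtain a h where Qa: "Q = cube a h" and h: "0 < h" and xQ: "x \<in> cube a h"
            using Q by (auto simp: cubes_def)
          have [measurable]: "Q \<in> sets lebesgue" by (simp add: Qa)
          have fin: "(\<integral>\<^sup>+ y \<in> Q. ennreal \<bar>f y\<bar> \<partial>lebesgue) < top"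
            unfolding Qa using f1[OF h, of a] by (rule order_le_less_trans) simp
          then obtain I where I: "0 \<le> I" "(\<integral>\<^sup>+ y \<in> Q. ennreal \<bar>f y\<bar> \<partial>lebesgue) = ennreal I"
            by (cases "\<integral>\<^sup>+ y \<in> Q. ennreal \<bar>f y\<bar> \<partial>lebesgue") auto
          define A where "A = I / h ^ CARD('n)"
          have A: "0 \<le> A" using I h by (simp add: A_def)
          have "I \<le> 2 * N * h powr ((lam - ?n) / p) * h ^ CARD('n)"
            using f1[OF h, of a] I N h by (simp add: Qa[symmetric] ennreal_le_iff)
          then have AW: "A \<le> 2 * N * h powr (- s)"
            using h by (simp add: A_def s_def divide_simps minus_divide_left)
          have osc: "\<bar>g x - g y\<bar> \<le> D * h powr \<beta>" if "y \<in> Q" for y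
          proof -
            have "norm (x - y) powr \<beta> \<le> (?n * h) powr \<beta>"
              using norm_diff_le_cube[OF xQ] that \<beta> by (intro powr_mono2) (auto simp: Qa)
            then have "C0 * norm (x - y) powr \<beta> \<le> \<bar>C0\<bar> * (?n * h) powr \<beta>"
              by (intro mult_mono) auto
            then show ?thesis
              using g[of x y] h by (simp add: D_def powr_mult mult_ac)
          qed
          have "(\<integral>\<^sup>+ y \<in> Q. ennreal (\<bar>b x - b y\<bar> * \<bar>f y\<bar>) \<partial>lebesgue)
              \<le> (\<integral>\<^sup>+ y. ennreal (D * h powr \<beta>) * (ennreal \<bar>f y\<bar> * indicator Q y) \<partial>lebesgue)"
          proof (rule nn_integral_mono_AE)
            show "AE y in lebesgue. ennreal (\<bar>b x - b y\<bar> * \<bar>f y\<bar>) * indicator Q y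
                    \<le> ennreal (D * h powr \<beta>) * (ennreal \<bar>f y\<bar> * indicator Q y)"
              using bg
            proof eventually_elim
              case (elim y)
              show ?case
                using osc[of y] D by (cases "y \<in> Q")
                  (auto simp: x elim ennreal_mult[symmetric] intro!: ennreal_leI mult_right_mono)
            qed
          qed
          also have "\<dots> = ennreal (D * h powr \<beta> * I)"
            using D I by (subst nn_integral_cmult) (auto simp: ennreal_mult)
          finally have "(\<integral>\<^sup>+ y \<in> Q. ennreal (\<bar>b x - b y\<bar> * \<bar>f y\<bar>) \<partial>lebesgue) / emeasure lebesgue Q
              \<le> ennreal (D * h powr \<beta> * I) / ennreal (h ^ CARD('n))"
            using h unfolding Qa by (subst emeasure_cube) (auto intro: divide_right_mono_ennreal)
          also have "\<dots> = ennreal (D * (h powr \<beta> * A))"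
            using D I h by (simp add: divide_ennreal A_def)
          also have "\<dots> \<le> (ennreal c1 * (maximal_function F x ennpowr p) + ennreal c2) ennpowr (1 / q)"
          proof -
            have "ennreal (D powr q * (h powr \<beta> * A) powr q) \<le> ennreal c1 * (maximal_function F x ennpowr p) + ennreal c2"
            proof (cases "h \<le> L")
              case True
              have "Q \<subseteq> Q3"
              proof
                fix y assume "y \<in> Q"
                then show "y \<in> Q3"
                  using xQ \<open>x \<in> cube c L\<close> True L unfolding Qa Q3_def mem_cube
                  by (auto) (smt (verit, best))+
              qed
              then have "(\<integral>\<^sup>+ y \<in> Q. ennreal \<bar>F y\<bar> \<partial>lebesgue) = ennreal I"
                unfolding I(2)[symmetric] by (intro nn_integral_cong) (auto simp: F_def indicator_def)
              then have "ennreal (A / \<kappa>) \<le> maximal_function F x"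
                using cube_average_le_maximal_function[OF xQ h I(1), of F] by (simp add: Qa A_def \<kappa>_def mult_ac)
              then have M: "ennreal ((A / \<kappa>) powr p) \<le> maximal_function F x ennpowr p"
                using ennpowr_mono[of "ennreal (A / \<kappa>)" _ p] A \<kappa> p by (simp add: ennpowr_ennreal)
              have "(h powr \<beta> * A) powr q \<le> A powr p * (2 * N) powr (q - p)"
                using fractional_average_le[OF A _ h _ sq AW] N pq by simp
              then have "D powr q * (h powr \<beta> * A) powr q \<le> D powr q * (A powr p * (2 * N) powr (q - p))"
                by (rule mult_left_mono) simp
              also have "\<dots> = c1 * (A / \<kappa>) powr p"
                using A \<kappa> by (simp add: c1_def powr_divide)
              finally have "ennreal (D powr q * (h powr \<beta> * A) powr q) \<le> ennreal c1 * ennreal ((A / \<kappa>) powr p)"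
                using c12 by (simp add: ennreal_mult[symmetric] ennreal_leI)
              also have "\<dots> \<le> ennreal c1 * (maximal_function F x ennpowr p)"
                by (intro mult_left_mono M) simp
              finally show ?thesis by (simp add: add_increasing2)
            next
              case False
              have "h powr \<beta> * A \<le> h powr \<beta> * (2 * N * h powr (- s))"
                by (intro mult_left_mono AW) simp
              also have "\<dots> = 2 * N * h powr (\<beta> - s)"
                using h by (simp add: powr_diff powr_minus field_simps)
              finally have "(h powr \<beta> * A) powr q \<le> (2 * N * h powr (\<beta> - s)) powr q"
                using A q0 by (intro powr_mono2) auto
              also have "\<dots> = (2 * N) powr q * h powr (lam - ?n)"
                using N by (simp add: powr_mult powr_powr sb)
              \<comment> \<open>The exponent \<open>lam - ?n\<close> is negative, so the larger side
                \<open>h\<close> may be replaced by \<open>L\<close>.\<close>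
              also have "\<dots> \<le> (2 * N) powr q * L powr (lam - ?n)"
                using False L nl by (intro mult_left_mono powr_mono2') auto
              finally have "D powr q * (h powr \<beta> * A) powr q \<le> c2"
                unfolding c2_def by (rule mult_left_mono) simp
              then show ?thesis
                by (simp add: add_increasing ennreal_leI)
            qed
            then show ?thesis
              using D A q0 by (subst ennpowr_le_iff[symmetric]) (auto simp: ennpowr_ennreal powr_mult)
          qed
          finally show ?thesis .
        qed
        then show ?thesis
          using q0 unfolding ennpowr_le_iff[OF q0] maximal_commutator_def by (intro SUP_least) auto
      qed
      have "(\<integral>\<^sup>+ x \<in> cube c L. maximal_commutator b f x ennpowr q \<partial>lebesgue)
          \<le> (\<integral>\<^sup>+ x. ennreal c1 * (maximal_function F x ennpowr p) + ennreal c2 * indicator (cube c L) x \<partial>lebesgue)"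
      proof (rule nn_integral_mono_AE)
        show "AE x in lebesgue. maximal_commutator b f x ennpowr q * indicator (cube c L) x
            \<le> ennreal c1 * (maximal_function F x ennpowr p) + ennreal c2 * indicator (cube c L) x"
          using bg by eventually_elim (auto simp: indicator_def intro: pt)
      qed
      also have "\<dots> = ennreal c1 * (\<integral>\<^sup>+ x. maximal_function F x ennpowr p \<partial>lebesgue) + ennreal c2 * ennreal (L ^ CARD('n))"
      proof -
        have [measurable]: "(\<lambda>x. maximal_function F x ennpowr p) \<in> borel_measurable lebesgue"
          unfolding ennpowr_def by measurable
        have [measurable]: "cube c L \<in> sets lebesgue" by simp
        have "emeasure lborel (cube c L) = ennreal (L ^ CARD('n))"
          using emeasure_cube[of L c] L by simp
        then show ?thesis
          by (subst nn_integral_add) (auto simp: nn_integral_cmult nn_integral_cmult_indicator)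
      qed
      also have "(\<integral>\<^sup>+ x. maximal_function F x ennpowr p \<partial>lebesgue) \<le> ennreal Kp * (\<integral>\<^sup>+ x. ennreal (\<bar>F x\<bar> powr p) \<partial>lebesgue)"
        unfolding Kp_def using maximal_function_strong_type[OF \<open>F \<in> borel_measurable lebesgue\<close> p] by simp
      also have "(\<integral>\<^sup>+ x. ennreal (\<bar>F x\<bar> powr p) \<partial>lebesgue) = (\<integral>\<^sup>+ x \<in> Q3. ennreal (\<bar>f x\<bar> powr p) \<partial>lebesgue)"
        by (intro nn_integral_cong) (auto simp: F_def indicator_def)
      also have "\<dots> \<le> ennreal (N powr p * (3 * L) powr lam)"
        unfolding Q3_def using fp[of "3 * L"] L by simp
      also have "ennreal c1 * (ennreal Kp * ennreal (N powr p * (3 * L) powr lam)) + ennreal c2 * ennreal (L ^ CARD('n))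
          = ennreal (c1 * (Kp * (N powr p * (3 * L) powr lam)) + c2 * L ^ CARD('n))"
        using c12 Kp L by (simp add: ennreal_mult ennreal_plus)
      also have "c1 * (Kp * (N powr p * (3 * L) powr lam)) + c2 * L ^ CARD('n) = (C * N) powr q * L powr lam"
      proof -
        have "(C * N) powr q = C powr q * N powr q"
          using N by (simp add: powr_mult C_def)
        also have "C powr q = D powr q * \<kappa> powr p * 2 powr (q - p) * Kp * 3 powr lam + D powr q * 2 powr q"
          using q0 Kp by (simp add: C_def powr_powr)
        finally have 1: "(C * N) powr q = (D powr q * \<kappa> powr p * 2 powr (q - p) * Kp * 3 powr lam + D powr q * 2 powr q) * N powr q" .
        have 2: "(2 * N) powr (q - p) * N powr p = 2 powr (q - p) * N powr q"
          using N by (simp add: powr_mult powr_add[symmetric] mult.assoc)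
        have 3: "L powr (lam - ?n) * L ^ CARD('n) = L powr lam"
          using L by (simp add: powr_realpow[symmetric] powr_add[symmetric])
        have "c1 * (Kp * (N powr p * (3 * L) powr lam)) = D powr q * \<kappa> powr p * Kp * ((2 * N) powr (q - p) * N powr p) * 3 powr lam * L powr lam"
          using L by (simp add: c1_def powr_mult mult_ac)
        moreover have "c2 * L ^ CARD('n) = D powr q * 2 powr q * N powr q * (L powr (lam - ?n) * L ^ CARD('n))"
          using N by (simp add: c2_def powr_mult mult_ac)
        ultimately show ?thesis
          unfolding 1 2 3 by (simp add: algebra_simps)
      qed
      finally show ?thesis by (simp add: add_right_mono mult_left_mono)
    qed
    then have "morrey_norm q lam (maximal_commutator b f) \<le> ennreal (C * N)"
      using q0 N by (subst morrey_norm_le_iff) (auto simp: C_def)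
    then show ?thesis
      using N by (simp add: ennreal_mult C_def)
  qed
  then show ?thesis
    unfolding bounded_morrey_def by blast
qed

section \<open>Functions of Hoelder mean oscillation\<close>

text \<open>A mean minus \<open>k\<close> is the mean of \<open>b - k\<close>. It is used with
  \<open>k\<close> the mean over a larger cube and with \<open>k\<close> a single value
  \<open>b x\<close>.\<close>

lemma average_minus_const_le:
  fixes b :: "'a \<Rightarrow> real"
  assumes E[measurable]: "E \<in> sets M" and m: "0 < m" "emeasure M E = ennreal m" and b: "set_integrable M E b"
  shows "ennreal (\<bar>(LINT y:E|M. b y) / m - k\<bar> * m) \<le> (\<integral>\<^sup>+ y \<in> E. ennreal \<bar>b y - k\<bar> \<partial>M)"
proof -
  have fin: "emeasure M E < \<infinity>" using m by simp
  have k: "set_integrable M E (\<lambda>y. k)"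
    unfolding set_integrable_def using fin by simp
  have eq: "(LINT y:E|M. b y - k) = (LINT y:E|M. b y) - k * m"
    using m fin by (subst set_integral_diff(2)[OF b k]) (simp add: set_lebesgue_integral_def measure_def)
  have "(LINT y:E|M. b y) / m - k = (LINT y:E|M. b y - k) / m"
    unfolding eq using m by (simp add: diff_divide_distrib)
  then have "\<bar>(LINT y:E|M. b y) / m - k\<bar> * m = \<bar>LINT y:E|M. b y - k\<bar>"
    using m by simp
  also have "ennreal \<dots> \<le> (\<integral>\<^sup>+ y. ennreal (norm (indicator E y *\<^sub>R (b y - k))) \<partial>M)"
    using integral_norm_bound_ennreal[OF set_integral_diff(1)[OF b k, unfolded set_integrable_def]]
    by (simp add: set_lebesgue_integral_def)
  also have "\<dots> = (\<integral>\<^sup>+ y \<in> E. ennreal \<bar>b y - k\<bar> \<partial>M)"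
    by (intro nn_integral_cong) (auto simp: indicator_def)
  finally show ?thesis .
qed

lemma geometric_increments_limit:
  fixes u :: "nat \<Rightarrow> real"
  assumes inc: "\<And>k. \<bar>u (Suc k) - u k\<bar> \<le> K * \<rho> ^ k" and \<rho>: "0 < \<rho>" "\<rho> < 1"
  obtains l where "u \<longlonglongrightarrow> l" "\<And>k. \<bar>u k - l\<bar> \<le> K * \<rho> ^ k / (1 - \<rho>)"
proof -
  have s: "summable (\<lambda>k. K * \<rho> ^ k)"
    using \<rho> by (intro summable_mult summable_geometric) simp
  have "summable (\<lambda>k. u (Suc k) - u k)"
    by (rule summable_comparison_test'[OF s, of 0]) (use inc in simp)
  then obtain L where "(\<lambda>n. \<Sum>k<n. u (Suc k) - u k) \<longlonglongrightarrow> L"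
    unfolding summable_def sums_def by blast
  then have "(\<lambda>n. u n - u 0) \<longlonglongrightarrow> L"
    by (simp add: sum_lessThan_telescope)
  then have "(\<lambda>n. u n - u 0 + u 0) \<longlonglongrightarrow> L + u 0"
    by (intro tendsto_add) auto
  then have lim: "u \<longlonglongrightarrow> L + u 0" by simp
  have K: "0 \<le> K" using inc[of 0] by simp
  have tail: "\<bar>u (k + j) - u k\<bar> \<le> K * \<rho> ^ k / (1 - \<rho>)" for k j
  proof -
    \<comment> \<open>The induction carries the exact finite geometric sum, since the bound by the
      full series would not survive adding an increment.\<close>
    have "\<bar>u (k + j) - u k\<bar> \<le> K * \<rho> ^ k * (1 - \<rho> ^ j) / (1 - \<rho>)"
    proof (induction j)
      case (Suc j)
      have "\<bar>u (k + Suc j) - u k\<bar> \<le> \<bar>u (Suc (k + j)) - u (k + j)\<bar> + \<bar>u (k + j) - u k\<bar>" by simp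
      also have "\<dots> \<le> K * \<rho> ^ (k + j) + K * \<rho> ^ k * (1 - \<rho> ^ j) / (1 - \<rho>)"
        by (intro add_mono inc Suc)
      also have "\<dots> = K * \<rho> ^ k * (1 - \<rho> ^ Suc j) / (1 - \<rho>)"
        using \<rho> by (simp add: field_simps power_add)
      finally show ?case .
    qed simp
    also have "\<dots> \<le> K * \<rho> ^ k * 1 / (1 - \<rho>)"
      using \<rho> K by (intro divide_right_mono mult_left_mono) auto
    finally show ?thesis by simp
  qed
  have lim_tail: "(\<lambda>j. \<bar>u (k + j) - u k\<bar>) \<longlonglongrightarrow> \<bar>L + u 0 - u k\<bar>" for k
    using LIMSEQ_ignore_initial_segment[OF lim, of k] by (intro tendsto_intros) (simp add: add.commute)
  have "\<bar>L + u 0 - u k\<bar> \<le> K * \<rho> ^ k / (1 - \<rho>)" for k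
    by (rule LIMSEQ_le_const2[OF lim_tail], rule exI[of _ 0]) (simp add: tail)
  then show ?thesis
    using that[OF lim] by (simp add: abs_minus_commute)
qed

section \<open>Vanishing from smallness on small cubes\<close>

text \<open>A ball is covered by disjoint grid cells of side \<open>h = 1 / 2 ^ k\<close>. Each has
  \<open>\<nu>\<close>-measure at most \<open>K * h powr \<beta>\<close> times its volume, and their
  total volume stays bounded as \<open>k\<close> grows, so the ball is
  \<open>\<nu>\<close>-null.\<close>

lemma AE_zero_of_small_cubes:
  fixes w :: "real ^ 'n \<Rightarrow> ennreal"
  assumes w[measurable]: "w \<in> borel_measurable lebesgue" and \<beta>: "0 < \<beta>" and K: "0 \<le> K"
    and small: "\<And>a k. (\<integral>\<^sup>+ x \<in> cube a (1 / 2 ^ k). w x \<partial>lebesgue) \<le> ennreal (K * (1 / 2 ^ k) powr \<beta> * (1 / 2 ^ k) ^ CARD('n))"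
  shows "AE x in lebesgue. w x = 0"
proof -
  define \<nu> where "\<nu> = density lebesgue w"
  have \<nu>: "emeasure \<nu> E = (\<integral>\<^sup>+ x \<in> E. w x \<partial>lebesgue)" if "E \<in> sets lebesgue" for E
    using that by (simp add: \<nu>_def emeasure_density)
  have sets_\<nu> [simp]: "sets \<nu> = sets lebesgue" by (simp add: \<nu>_def)
  have ball0: "emeasure \<nu> (ball 0 R) = 0" for R :: real
  proof -
    \<comment> \<open>Since \<open>h \<le> 1\<close>, all cells meeting the ball lie in this
      enlarged ball, whatever \<open>k\<close> is.\<close>
    define T where "T = measure lebesgue (ball (0 :: real ^ 'n) (R + real CARD('n) + 1))"
    have "emeasure \<nu> (ball 0 R) \<le> ennreal (K * T * (1 / 2 ^ k) powr \<beta>)" for k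
    proof -
      define h :: real where "h = 1 / 2 ^ k"
      have h: "0 < h" "h \<le> 1" by (auto simp: h_def)
      \<comment> \<open>Half-open cells partition the space exactly. Each lies between an open box
        and a closed cube of the same volume, which transfers the hypothesis on closed cubes to
        cells.\<close>
      define cell where "cell v = {x :: real ^ 'n. \<forall>i. \<lfloor>x $ i / h\<rfloor> = v $ i}" for v :: "int ^ 'n"
      define corner :: "int ^ 'n \<Rightarrow> real ^ 'n" where "corner v = (\<chi> i. h * of_int (v $ i))" for v
      have cell_iff: "x \<in> cell v \<longleftrightarrow> (\<forall>i. corner v $ i \<le> x $ i \<and> x $ i < corner v $ i + h)" for x v
        using h by (auto simp: cell_def corner_def floor_eq_iff field_simps)
      have [measurable]: "cell v \<in> sets lebesgue" for v
      proof -
        have "cell v = (\<Inter>i. {x. corner v $ i \<le> x $ i} \<inter> {x. x $ i < corner v $ i + h})"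
          by (auto simp: cell_iff)
        also have "\<dots> \<in> sets borel"
          by (intro sets.countable_INT' sets.Int borel_closed borel_open closed_halfspace_component_ge_cart open_halfspace_component_lt_cart)
             (auto simp: closed_Collect_le open_Collect_less continuous_intros)
        finally show ?thesis by simp
      qed
      have sub: "cell v \<subseteq> cube (corner v) h" for v
        by (auto simp: cell_iff mem_cube less_imp_le)
      have sup: "box (corner v) (corner v + (\<chi> i. h)) \<subseteq> cell v" for v
        by (auto simp: cell_iff mem_box_cart less_imp_le)
      have size: "ennreal (h ^ CARD('n)) \<le> emeasure lebesgue (cell v)" for v
      proof -
        have "emeasure lebesgue (box (corner v) (corner v + (\<chi> i. h))) = emeasure lebesgue (cube (corner v) h)"
          by (simp add: emeasure_lborel_box_eq emeasure_lborel_cbox_eq)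
        then show ?thesis
          using emeasure_mono[OF sup[of v], of lebesgue] h by (simp only: emeasure_cube[OF less_imp_le]) simp
      qed
      have cell_le: "emeasure \<nu> (cell v) \<le> ennreal (K * h powr \<beta>) * emeasure lebesgue (cell v)" for v
      proof -
        have "emeasure \<nu> (cell v) \<le> (\<integral>\<^sup>+ x \<in> cube (corner v) h. w x \<partial>lebesgue)"
          by (subst \<nu>) (auto dest: sub[THEN subsetD] intro!: nn_integral_mono mult_left_mono simp: indicator_def)
        also have "\<dots> \<le> ennreal (K * h powr \<beta> * h ^ CARD('n))"
          using small unfolding h_def .
        also have "\<dots> = ennreal (K * h powr \<beta>) * ennreal (h ^ CARD('n))"
          using K h by (simp add: ennreal_mult)
        also have "\<dots> \<le> ennreal (K * h powr \<beta>) * emeasure lebesgue (cell v)"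
          by (intro mult_left_mono size) simp
        finally show ?thesis .
      qed
      define V where "V = {v. cell v \<inter> ball 0 R \<noteq> {}}"
      have disj: "disjoint_family_on cell V"
        by (auto simp: disjoint_family_on_def cell_def vec_eq_iff)
      have big: "(\<Union>v\<in>V. cell v) \<subseteq> ball 0 (R + real CARD('n) + 1)"
      proof clarify
        fix v x assume "v \<in> V" and x: "x \<in> cell v"
        then obtain y where y: "y \<in> cell v" "norm y < R" by (auto simp: V_def)
        have "norm (x - y) \<le> real CARD('n) * h"
          using x y sub by (blast intro: norm_diff_le_cube)
        also have "\<dots> \<le> real CARD('n)" using h by (simp add: mult_left_le)
        finally show "x \<in> ball 0 (R + real CARD('n) + 1)"
          using y norm_triangle_sub[of x y] by simp
      qed
      have "ball 0 R \<subseteq> (\<Union>v\<in>V. cell v)"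
      proof
        fix x :: "real ^ 'n" assume "x \<in> ball 0 R"
        moreover have "x \<in> cell (\<chi> i. \<lfloor>x $ i / h\<rfloor>)" by (simp add: cell_def)
        ultimately show "x \<in> (\<Union>v\<in>V. cell v)" unfolding V_def by blast
      qed
      then have "emeasure \<nu> (ball 0 R) \<le> emeasure \<nu> (\<Union>v\<in>V. cell v)"
        by (intro emeasure_mono) auto
      also have "\<dots> = (\<integral>\<^sup>+ v. emeasure \<nu> (cell v) \<partial>count_space V)"
        using disj by (intro emeasure_UN_countable) auto
      also have "\<dots> \<le> (\<integral>\<^sup>+ v. ennreal (K * h powr \<beta>) * emeasure lebesgue (cell v) \<partial>count_space V)"
        by (intro nn_integral_mono cell_le)
      also have "\<dots> = ennreal (K * h powr \<beta>) * emeasure lebesgue (\<Union>v\<in>V. cell v)"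
        using disj by (subst emeasure_UN_countable) (auto simp: nn_integral_cmult)
      also have "\<dots> \<le> ennreal (K * h powr \<beta>) * emeasure lebesgue (ball (0 :: real ^ 'n) (R + real CARD('n) + 1))"
        by (intro mult_left_mono emeasure_mono big) auto
      also have "\<dots> = ennreal (K * h powr \<beta>) * ennreal T"
        unfolding T_def using emeasure_lborel_ball_finite[of "0 :: real ^ 'n" "R + real CARD('n) + 1"]
        by (subst emeasure_eq_ennreal_measure) (auto simp: top.not_eq_extremum)
      also have "\<dots> = ennreal (K * T * h powr \<beta>)"
        using K by (simp add: ennreal_mult[symmetric] T_def mult_ac)
      finally show ?thesis by (simp add: h_def)
    qed
    moreover have lim: "(\<lambda>k. ennreal (K * T * (1 / 2 ^ k) powr \<beta>)) \<longlonglongrightarrow> ennreal 0"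
    proof (rule tendsto_ennrealI)
      have "(\<lambda>k. (1 / 2 :: real) ^ k) \<longlonglongrightarrow> 0" by (rule LIMSEQ_realpow_zero) auto
      then have "(\<lambda>k. (1 / 2 ^ k :: real) powr \<beta>) \<longlonglongrightarrow> 0"
        using \<beta> by (intro tendsto_zero_powrI[where b = \<beta>]) (auto simp: power_divide)
      then show "(\<lambda>k. K * T * (1 / 2 ^ k) powr \<beta>) \<longlonglongrightarrow> 0"
        by (rule tendsto_mult_right_zero)
    qed
    ultimately have "emeasure \<nu> (ball 0 R) \<le> ennreal 0"
      by (intro LIMSEQ_le_const[OF lim]) blast
    then show ?thesis by simp
  qed
  have "emeasure \<nu> (\<Union>k::nat. ball 0 (real k)) = 0"
    using ball0 by (intro emeasure_UN_eq_0) auto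
  moreover have "(\<Union>k::nat. ball (0 :: real ^ 'n) (real k)) = UNIV"
    using reals_Archimedean2 by auto
  ultimately have "(\<integral>\<^sup>+ x. w x \<partial>lebesgue) = 0"
    using \<nu>[of UNIV] by simp
  then show ?thesis
    by (subst (asm) nn_integral_0_iff_AE) auto
qed

lemma borel_measurable_of_locally_integrable:
  fixes b :: "real ^ 'n \<Rightarrow> real"
  assumes b: "locally_integrable b"
  shows "b \<in> borel_measurable lebesgue"
proof (rule borel_measurable_LIMSEQ_real)
  fix k :: nat
  show "(\<lambda>x. indicator (cball 0 (real k)) x *\<^sub>R b x) \<in> borel_measurable lebesgue"
    using b by (auto simp: locally_integrable_def set_integrable_def intro: borel_measurable_integrable)
next
  fix x :: "real ^ 'n"
  obtain k0 :: nat where "norm x \<le> real k0" using real_arch_simple by blast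
  then have "\<forall>k\<ge>k0. indicator (cball 0 (real k)) x *\<^sub>R b x = b x" by (auto simp: indicator_def)
  then show "(\<lambda>k. indicator (cball 0 (real k)) x *\<^sub>R b x) \<longlonglongrightarrow> b x"
    by (intro tendsto_eventually) (auto simp: eventually_sequentially)
qed

section \<open>Campanato's characterisation of Hoelder functions\<close>

lemma campanato_imp_lipschitz:
  fixes b :: "real ^ 'n \<Rightarrow> real" and \<beta> C :: real
  defines "m \<equiv> \<lambda>a h. (LINT y:cube a h|lebesgue. b y) / h ^ CARD('n)"
  assumes b: "locally_integrable b" and \<beta>: "0 < \<beta>" and C: "0 \<le> C"
    and osc: "\<And>a h. 0 < h \<Longrightarrow>
      (\<integral>\<^sup>+ x \<in> cube a h. ennreal \<bar>b x - m a h\<bar> \<partial>lebesgue) \<le> ennreal (C * h powr \<beta> * h ^ CARD('n))"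
  shows "b \<in> lipschitz_space \<beta>"
proof -
  let ?n = "CARD('n)"
  have m_eq: "m a h = (LINT y:cube a h|lebesgue. b y) / h ^ ?n" for a h
    by (simp add: m_def)
  have b_int: "set_integrable lebesgue (cube a h) b" for a h
    using b by (simp add: locally_integrable_def)
  \<comment> \<open>The oscillation about \<open>m a h\<close> over the small cube is at most that
    over the large one; the ratio of volumes is the price of normalising by the small cube.\<close>
  have nested: "\<bar>m a' h' - m a h\<bar> \<le> C * (h / h') ^ ?n * h powr \<beta>"
    if "0 < h'" "0 < h" "cube a' h' \<subseteq> cube a h" for a a' h h'
  proof -
    have "ennreal (\<bar>m a' h' - m a h\<bar> * h' ^ ?n) \<le> (\<integral>\<^sup>+ x \<in> cube a' h'. ennreal \<bar>b x - m a h\<bar> \<partial>lebesgue)"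
      unfolding m_eq[of a' h']
      by (rule average_minus_const_le) (use that in \<open>simp_all only: emeasure_cube less_imp_le b_int zero_less_power\<close>, simp)
    also have "\<dots> \<le> (\<integral>\<^sup>+ x \<in> cube a h. ennreal \<bar>b x - m a h\<bar> \<partial>lebesgue)"
      using that(3) by (intro nn_integral_mono) (auto simp: indicator_def)
    also have "\<dots> \<le> ennreal (C * h powr \<beta> * h ^ ?n)"
      by (rule osc) fact
    finally have "\<bar>m a' h' - m a h\<bar> * h' ^ ?n \<le> C * h powr \<beta> * h ^ ?n"
      using C that by (simp add: ennreal_le_iff)
    then show ?thesis
      using that by (simp add: field_simps power_divide)
  qed
  define \<rho> where "\<rho> = (1 / 2 :: real) powr \<beta>"
  have \<rho>: "0 < \<rho>" "\<rho> < 1"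
    using \<beta> powr_less_mono2[of \<beta> "1 / 2" 1] by (auto simp: \<rho>_def)
  \<comment> \<open>Halving the side costs \<open>2 ^ ?n\<close> in \<open>nested\<close>, and
    \<open>1 / (1 - \<rho>)\<close> sums the geometric series of errors.\<close>
  define C1 where "C1 = C * 2 ^ ?n / (1 - \<rho>)"
  have C1: "0 \<le> C1" using C \<rho> by (simp add: C1_def)
  have pow: "(r / 2 ^ k) powr \<beta> = r powr \<beta> * \<rho> ^ k" if "0 < r" for r :: real and k
    using that by (simp add: \<rho>_def powr_divide powr_realpow[symmetric] powr_powr mult.commute)
  \<comment> \<open>The shrinking cubes keep \<open>x\<close> as their lower corner. At this point
    the limit may still depend on the initial side \<open>r\<close>.\<close>
  have ex: "\<exists>l. (\<lambda>k. m x (r / 2 ^ k)) \<longlonglongrightarrow> l \<and> \<bar>m x r - l\<bar> \<le> C1 * r powr \<beta>" if r: "0 < r" for x r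
  proof -
    have "\<bar>m x (r / 2 ^ Suc k) - m x (r / 2 ^ k)\<bar> \<le> (C * 2 ^ ?n * r powr \<beta>) * \<rho> ^ k" for k
    proof -
      have "r / 2 ^ Suc k \<le> r / 2 ^ k" using r by (simp add: field_simps)
      then have "cube x (r / 2 ^ Suc k) \<subseteq> cube x (r / 2 ^ k)"
        by (simp only: subset_iff mem_cube) (meson add_left_mono order_trans)
      from nested[OF _ _ this] r have "\<bar>m x (r / 2 ^ Suc k) - m x (r / 2 ^ k)\<bar> \<le> C * 2 ^ ?n * (r / 2 ^ k) powr \<beta>"
        by (simp add: field_simps)
      then show ?thesis using pow[OF r, of k] by (simp add: mult.assoc)
    qed
    from geometric_increments_limit[of "\<lambda>k. m x (r / 2 ^ k)", OF this \<rho>]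
    obtain l where "(\<lambda>k. m x (r / 2 ^ k)) \<longlonglongrightarrow> l"
      "\<And>k. \<bar>m x (r / 2 ^ k) - l\<bar> \<le> C * 2 ^ ?n * r powr \<beta> * \<rho> ^ k / (1 - \<rho>)" by blast
    from this(1) this(2)[of 0] show ?thesis
      by (intro exI[of _ l]) (simp add: C1_def)
  qed
  then have "\<exists>g. \<forall>x. (\<lambda>k. m x (1 / 2 ^ k)) \<longlonglongrightarrow> g x"
    by (intro choice) (metis zero_less_one)
  then obtain g where lim: "\<And>x. (\<lambda>k. m x (1 / 2 ^ k)) \<longlonglongrightarrow> g x" by blast
  \<comment> \<open>For \<open>r\<close> a power of two, the sides \<open>r / 2 ^ k\<close> and
    \<open>1 / 2 ^ k\<close> agree after shifts by \<open>nat z\<close> and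
    \<open>nat (- z)\<close>, one of which is 0. So the limit is \<open>g x\<close>.\<close>
  have approx: "\<bar>m x (2 powr of_int z) - g x\<bar> \<le> C1 * (2 powr of_int z) powr \<beta>" for x and z :: int
  proof -
    define r :: real where "r = 2 powr of_int z"
    obtain l where l: "(\<lambda>k. m x (r / 2 ^ k)) \<longlonglongrightarrow> l" "\<bar>m x r - l\<bar> \<le> C1 * r powr \<beta>"
      using ex[of r x] by (auto simp: r_def)
    have "r / 2 ^ (k + nat z) = 1 / 2 ^ (k + nat (- z))" for k
      unfolding r_def
      by (cases "0 \<le> z") (simp_all add: powr_realpow[symmetric] powr_add[symmetric] field_simps)
    then have "(\<lambda>k. m x (1 / 2 ^ (k + nat (- z)))) \<longlonglongrightarrow> l"
      using LIMSEQ_ignore_initial_segment[OF l(1), of "nat z"] by simp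
    moreover have "(\<lambda>k. m x (1 / 2 ^ (k + nat (- z)))) \<longlonglongrightarrow> g x"
      by (rule LIMSEQ_ignore_initial_segment[OF lim])
    ultimately have "l = g x" by (rule LIMSEQ_unique)
    then show ?thesis using l(2) by (simp add: r_def)
  qed
  \<comment> \<open>Two approximation errors and two comparisons with a common cube of side
    \<open>2 * R\<close>; the last factor \<open>2 powr \<beta>\<close> pays for rounding the
    distance up to \<open>R\<close>.\<close>
  define C2 where "C2 = (2 * C1 + 2 * (C * 2 ^ ?n * 2 powr \<beta>)) * 2 powr \<beta>"
  have C2: "0 \<le> C2" using C1 C by (simp add: C2_def)
  have holder: "\<bar>g x - g y\<bar> \<le> C2 * norm (x - y) powr \<beta>" for x y
  proof (cases "x = y")
    case False
    define d where "d = norm (x - y)"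
    \<comment> \<open>The distance is rounded up to a power of two, because \<open>approx\<close> is
      available only for such sides.\<close>
    define R :: real where "R = 2 powr of_int \<lceil>log 2 d\<rceil>"
    have d: "0 < d" using False by (simp add: d_def)
    have "d = 2 powr (log 2 d)" using d by simp
    also have "\<dots> \<le> R" unfolding R_def by (intro powr_mono) auto
    finally have dR: "d \<le> R" .
    have "R \<le> 2 powr (log 2 d + 1)"
      unfolding R_def by (intro powr_mono) (auto simp: ceiling_le_iff intro: less_imp_le of_int_ceiling_le_add_one)
    also have "\<dots> = 2 * d" using d by (simp add: powr_add)
    finally have Rd: "R \<le> 2 * d" .
    have R: "0 < R" by (simp add: R_def)
    \<comment> \<open>With the componentwise minimum as corner, one cube of side
      \<open>2 * R\<close> contains both cubes of side \<open>R\<close>.\<close>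
    define w where "w = (\<chi> i. min (x $ i) (y $ i))"
    have comp: "\<bar>x $ i - y $ i\<bar> \<le> R" for i
      using component_le_norm_cart[of "x - y" i] dR by (simp add: d_def)
    have sub: "cube x R \<subseteq> cube w (2 * R)" "cube y R \<subseteq> cube w (2 * R)"
      unfolding subset_iff mem_cube w_def using comp by (auto simp: min_def abs_le_iff) (smt (verit))+
    have near: "\<bar>m x R - m w (2 * R)\<bar> \<le> C * 2 ^ ?n * (2 * R) powr \<beta>"
      "\<bar>m y R - m w (2 * R)\<bar> \<le> C * 2 ^ ?n * (2 * R) powr \<beta>"
      using nested[OF R _ sub(1)] nested[OF R _ sub(2)] R by auto
    have "\<bar>g x - g y\<bar> \<le> 2 * (C1 * R powr \<beta>) + 2 * (C * 2 ^ ?n * (2 * R) powr \<beta>)"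
      using approx[of x "\<lceil>log 2 d\<rceil>"] approx[of y "\<lceil>log 2 d\<rceil>"] near unfolding R_def[symmetric] by linarith
    also have "\<dots> = (2 * C1 + 2 * (C * 2 ^ ?n * 2 powr \<beta>)) * R powr \<beta>"
      using R by (simp add: powr_mult algebra_simps)
    also have "\<dots> \<le> (2 * C1 + 2 * (C * 2 ^ ?n * 2 powr \<beta>)) * (2 * d) powr \<beta>"
      using C1 C R Rd \<beta> by (intro mult_left_mono powr_mono2) auto
    also have "\<dots> = C2 * d powr \<beta>"
      using d by (simp add: C2_def powr_mult)
    finally show ?thesis by (simp add: d_def)
  qed simp
  \<comment> \<open>Continuity supplies the measurability of \<open>g\<close>, needed to integrate
    \<open>\<bar>b - g\<bar>\<close>.\<close>
  have "continuous_on UNIV g"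
    unfolding continuous_on_def
  proof
    fix x :: "real ^ 'n"
    have "((\<lambda>y. C2 * norm (y - x) powr \<beta>) \<longlongrightarrow> 0) (at x)"
    proof (rule tendsto_mult_right_zero)
      have "((\<lambda>y. norm (y - x)) \<longlongrightarrow> 0) (at x)"
        by (intro tendsto_eq_intros) auto
      then show "((\<lambda>y. norm (y - x) powr \<beta>) \<longlongrightarrow> 0) (at x)"
        using \<beta> by (intro tendsto_zero_powrI[where b = \<beta>]) auto
    qed
    then have "((\<lambda>y. g y - g x) \<longlongrightarrow> 0) (at x)"
      by (rule Lim_null_comparison[rotated]) (simp add: holder)
    then show "(g \<longlongrightarrow> g x) (at x)"
      by (simp add: Lim_null[symmetric])
  qed
  then have [measurable]: "g \<in> borel_measurable lebesgue"
    by (simp add: borel_measurable_continuous_onI measurable_completion)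
  note [measurable] = borel_measurable_of_locally_integrable[OF b]
  \<comment> \<open>The three terms are the oscillation of \<open>b\<close> about its mean, the
    distance from that mean to \<open>g a\<close>, and the variation of \<open>g\<close> over the
    cube.\<close>
  define K where "K = C + C1 + C2 * real ?n powr \<beta>"
  have "AE x in lebesgue. ennreal \<bar>b x - g x\<bar> = 0"
  proof (rule AE_zero_of_small_cubes[OF _ \<beta>])
    show "0 \<le> K" using C C1 C2 by (simp add: K_def)
    fix a :: "real ^ 'n" and k :: nat
    define h :: real where "h = 1 / 2 ^ k"
    have h: "0 < h" by (simp add: h_def)
    have h_eq: "h = 2 powr of_int (- int k)"
      by (simp add: h_def powr_minus powr_realpow divide_inverse)
    have ga: "\<bar>g x - m a h\<bar> \<le> (C1 + C2 * real ?n powr \<beta>) * h powr \<beta>" if "x \<in> cube a h" for x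
    proof -
      have "a \<in> cube a h" using h by (simp add: mem_cube less_imp_le del: mem_box)
      then have "norm (x - a) powr \<beta> \<le> (real ?n * h) powr \<beta>"
        using norm_diff_le_cube[OF that] \<beta> by (intro powr_mono2) auto
      then have "C2 * norm (x - a) powr \<beta> \<le> C2 * (real ?n powr \<beta> * h powr \<beta>)"
        using C2 h by (intro mult_left_mono) (auto simp: powr_mult)
      then show ?thesis
        using holder[of x a] approx[of a "- int k"] unfolding h_eq[symmetric] by (simp add: algebra_simps)
    qed
    have "(\<integral>\<^sup>+ x \<in> cube a h. ennreal \<bar>b x - g x\<bar> \<partial>lebesgue)
      \<le> (\<integral>\<^sup>+ x. ennreal \<bar>b x - m a h\<bar> * indicator (cube a h) x
            + ennreal ((C1 + C2 * real ?n powr \<beta>) * h powr \<beta>) * indicator (cube a h) x \<partial>lebesgue)"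
    proof (rule nn_integral_mono)
      fix x
      show "ennreal \<bar>b x - g x\<bar> * indicator (cube a h) x \<le> ennreal \<bar>b x - m a h\<bar> * indicator (cube a h) x
            + ennreal ((C1 + C2 * real ?n powr \<beta>) * h powr \<beta>) * indicator (cube a h) x"
      proof (cases "x \<in> cube a h")
        case True
        have "\<bar>b x - g x\<bar> \<le> \<bar>b x - m a h\<bar> + (C1 + C2 * real ?n powr \<beta>) * h powr \<beta>"
          using ga[OF True] by linarith
        then have "ennreal \<bar>b x - g x\<bar> \<le> ennreal \<bar>b x - m a h\<bar> + ennreal ((C1 + C2 * real ?n powr \<beta>) * h powr \<beta>)"
          using C1 C2 by (subst ennreal_plus[symmetric]) (auto intro: ennreal_leI simp del: ennreal_plus)
        then show ?thesis using True by simp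
      qed simp
    qed
    also have "\<dots> = (\<integral>\<^sup>+ x \<in> cube a h. ennreal \<bar>b x - m a h\<bar> \<partial>lebesgue)
        + ennreal ((C1 + C2 * real ?n powr \<beta>) * h powr \<beta>) * emeasure lebesgue (cube a h)"
    proof -
      have [measurable]: "cube a h \<in> sets lebesgue" by simp
      show ?thesis
        by (subst nn_integral_add) (auto simp: nn_integral_cmult_indicator)
    qed
    also have "\<dots> \<le> ennreal (C * h powr \<beta> * h ^ ?n) + ennreal ((C1 + C2 * real ?n powr \<beta>) * h powr \<beta>) * ennreal (h ^ ?n)"
      using osc[OF h] by (simp only: emeasure_cube[OF less_imp_le[OF h]]) (rule add_right_mono)
    also have "\<dots> = ennreal (K * h powr \<beta> * h ^ ?n)"
      using C C1 C2 h by (simp add: K_def ennreal_mult[symmetric] ennreal_plus[symmetric] algebra_simps del: ennreal_plus)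
    finally show "(\<integral>\<^sup>+ x \<in> cube a (1 / 2 ^ k). ennreal \<bar>b x - g x\<bar> \<partial>lebesgue)
        \<le> ennreal (K * (1 / 2 ^ k) powr \<beta> * (1 / 2 ^ k) ^ ?n)"
      by (simp only: h_def)
  qed measurable
  then have "AE x in lebesgue. b x = g x"
    by eventually_elim simp
  then show ?thesis
    unfolding lipschitz_space_def using holder by blast
qed

section \<open>Boundedness of the maximal commutator\<close>

lemma indicator_cube_morrey:
  fixes a :: "real ^ 'n" and p lam h :: real
  assumes p: "0 < p" and lam: "0 \<le> lam" "lam \<le> real CARD('n)" and h: "0 < h"
  shows "indicator (cube a h) \<in> morrey_space p lam"
    and "morrey_norm p lam (\<lambda>x. ennreal \<bar>indicator (cube a h) x :: real\<bar>)
           \<le> ennreal (h powr ((real CARD('n) - lam) / p))"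
proof -
  let ?f = "indicator (cube a h) :: real ^ 'n \<Rightarrow> real"
  show norm: "morrey_norm p lam (\<lambda>x. ennreal \<bar>?f x\<bar>) \<le> ennreal (h powr ((real CARD('n) - lam) / p))"
  proof (subst morrey_norm_le_iff, use p in simp, simp, safe)
    fix a' :: "real ^ 'n" and h' :: real
    assume h': "0 < h'"
    define r where "r = min h h'"
    have r: "0 < r" using h h' by (simp add: r_def)
    have "(\<integral>\<^sup>+ x \<in> cube a' h'. ennreal \<bar>?f x\<bar> ennpowr p \<partial>lebesgue)
        = (\<integral>\<^sup>+ x. indicator (cube a h \<inter> cube a' h') x \<partial>lebesgue)"
      using p by (intro nn_integral_cong) (auto simp: indicator_def ennpowr_def)
    also have "\<dots> = emeasure lebesgue (cube a h \<inter> cube a' h')"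
      by (rule nn_integral_indicator) auto
    also have "\<dots> \<le> min (emeasure lebesgue (cube a h)) (emeasure lebesgue (cube a' h'))"
      by (intro min.boundedI emeasure_mono) auto
    also have "\<dots> \<le> ennreal (r ^ CARD('n))"
      using h h' by (simp only: emeasure_cube less_imp_le) (auto simp: r_def min_def)
    \<comment> \<open>The intersection has volume at most \<open>r ^ CARD('n)\<close>. Splitting
      this power lets one factor be bounded by the side \<open>h\<close> and the other by
      \<open>h'\<close>, as both exponents are nonnegative.\<close>
    also have "r ^ CARD('n) = r powr (real CARD('n) - lam) * r powr lam"
      using r by (simp add: powr_realpow[symmetric] powr_add[symmetric])
    also have "\<dots> \<le> h powr (real CARD('n) - lam) * h' powr lam"
      using r lam by (intro mult_mono powr_mono2) (auto simp: r_def)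
    also have "h powr (real CARD('n) - lam) = (h powr ((real CARD('n) - lam) / p)) powr p"
      using p by (simp add: powr_powr)
    finally show "(\<integral>\<^sup>+ x \<in> cube a' h'. ennreal \<bar>?f x\<bar> ennpowr p \<partial>lebesgue)
        \<le> ennreal ((h powr ((real CARD('n) - lam) / p)) powr p * h' powr lam)"
      by (simp add: ennreal_leI)
  qed
  have "(\<lambda>x. \<bar>?f x\<bar> powr p) = ?f"
    using p by (auto simp: indicator_def)
  moreover have "locally_integrable ?f"
    unfolding locally_integrable_def set_integrable_def
  proof (intro allI impI)
    fix S :: "(real ^ 'n) set" assume "compact S"
    then have "S \<inter> cube a h \<in> lmeasurable"
      by (intro lmeasurable_compact compact_Int_closed) auto
    then have "integrable lebesgue (indicator (S \<inter> cube a h) :: _ \<Rightarrow> real)"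
      by (intro integrable_real_indicator) (auto simp only: fmeasurable_def mem_Collect_eq infinity_ennreal_def)
    moreover have "(\<lambda>x. indicator S x *\<^sub>R ?f x) = indicator (S \<inter> cube a h)"
      by (auto simp: indicator_def)
    ultimately show "integrable lebesgue (\<lambda>x. indicator S x *\<^sub>R ?f x)"
      by simp
  qed
  moreover have "?f \<in> borel_measurable lebesgue"
    by (rule borel_measurable_indicator) simp
  ultimately show "?f \<in> morrey_space p lam"
    using norm by (auto simp: morrey_space_def intro: order_le_less_trans)
qed

text \<open>On a cube \<open>Q\<close> the commutator of the indicator of \<open>Q\<close> dominates
  \<open>\<bar>b - m\<bar>\<close>, where \<open>m\<close> is the mean of \<open>b\<close> over
  \<open>Q\<close>. The Morrey bounds then control the q-th power oscillation, and the relation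
  between \<open>p\<close> and \<open>q\<close> leaves the factor
  \<open>h powr \<beta>\<close>.\<close>

lemma bounded_maximal_commutator_imp_lipschitz:
  fixes b :: "real ^ 'n \<Rightarrow> real" and \<beta> p q lam :: real
  assumes b: "locally_integrable b" and \<beta>: "0 < \<beta>" and p: "0 < p" and q1: "1 < q"
    and lam: "0 \<le> lam" "lam < real CARD('n)"
    and q: "1 / q = 1 / p - \<beta> / (real CARD('n) - lam)"
    and bounded: "bounded_morrey (maximal_commutator b) p q lam"
  shows "b \<in> lipschitz_space \<beta>"
proof -
  let ?n = "CARD('n)"
  obtain C0 where C0: "\<And>f. f \<in> morrey_space p lam \<Longrightarrow>
      morrey_norm q lam (maximal_commutator b f) \<le> ennreal C0 * morrey_norm p lam (\<lambda>x. ennreal \<bar>f x\<bar>)"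
    using bounded unfolding bounded_morrey_def by blast
  \<comment> \<open>The bounding constant is an arbitrary real and \<open>ennreal\<close> sends
    negative numbers to 0.\<close>
  define C where "C = max C0 0"
  have C: "0 \<le> C" "ennreal C0 = ennreal C"
    by (auto simp: C_def max_def ennreal_neg)
  have [measurable]: "cube a h \<in> sets lebesgue" for a :: "real ^ 'n" and h by simp
  define m where "m a h = (LINT y:cube a h|lebesgue. b y) / h ^ ?n" for a h
  have "(\<integral>\<^sup>+ x \<in> cube a h. ennreal \<bar>b x - m a h\<bar> \<partial>lebesgue) \<le> ennreal (2 * C * h powr \<beta> * h ^ ?n)"
    if h: "0 < h" for a h
  proof -
    let ?f = "indicator (cube a h) :: real ^ 'n \<Rightarrow> real"
    have b_int: "set_integrable lebesgue (cube a h) b"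
      using b by (simp add: locally_integrable_def)
    have hn: "0 < h ^ ?n" "0 \<le> h ^ ?n" using h by auto
    define W where "W = C * h powr ((real ?n - lam) / p)"
    have W: "0 \<le> W" using C by (simp add: W_def)
    have "morrey_norm q lam (maximal_commutator b ?f) \<le> ennreal C0 * morrey_norm p lam (\<lambda>x. ennreal \<bar>?f x\<bar>)"
      by (rule C0[OF indicator_cube_morrey(1)]) (use p lam h in auto)
    also have "\<dots> \<le> ennreal C * ennreal (h powr ((real ?n - lam) / p))"
      unfolding C(2) by (rule mult_left_mono[OF indicator_cube_morrey(2)]) (use p lam h in auto)
    finally have "morrey_norm q lam (maximal_commutator b ?f) \<le> ennreal W"
      using C by (simp add: W_def ennreal_mult)
    then have M: "(\<integral>\<^sup>+ x \<in> cube a h. maximal_commutator b ?f x ennpowr q \<partial>lebesgue) \<le> ennreal (W powr q * h powr lam)"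
      using q1 W h by (subst (asm) morrey_norm_le_iff) auto
    \<comment> \<open>The cube itself competes in the supremum, and averaging
      \<open>\<bar>b x - b y\<bar>\<close> over it bounds the distance from \<open>b x\<close> to
      the mean.\<close>
    have pt: "ennreal \<bar>b x - m a h\<bar> \<le> maximal_commutator b ?f x" if x: "x \<in> cube a h" for x
    proof -
      have "ennreal (\<bar>m a h - b x\<bar> * h ^ ?n) \<le> (\<integral>\<^sup>+ y \<in> cube a h. ennreal \<bar>b y - b x\<bar> \<partial>lebesgue)"
        unfolding m_def
        by (rule average_minus_const_le[OF _ hn(1) _ b_int]) (use h in \<open>simp_all only: emeasure_cube less_imp_le\<close>, simp)
      also have "\<dots> = (\<integral>\<^sup>+ y \<in> cube a h. ennreal (\<bar>b x - b y\<bar> * \<bar>?f y\<bar>) \<partial>lebesgue)"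
        by (intro nn_integral_cong) (auto simp: indicator_def abs_minus_commute)
      finally have "ennreal (\<bar>b x - m a h\<bar> * h ^ ?n) / emeasure lebesgue (cube a h)
          \<le> (\<integral>\<^sup>+ y \<in> cube a h. ennreal (\<bar>b x - b y\<bar> * \<bar>?f y\<bar>) \<partial>lebesgue) / emeasure lebesgue (cube a h)"
        by (subst abs_minus_commute) (rule divide_right_mono_ennreal)
      also have "\<dots> \<le> maximal_commutator b ?f x"
        unfolding maximal_commutator_def using x h by (intro SUP_upper) (auto simp: cubes_def)
      finally show ?thesis
        using h hn by (simp only: emeasure_cube[OF less_imp_le[OF h]]) (simp add: divide_ennreal)
    qed
    have "(\<integral>\<^sup>+ x \<in> cube a h. ennreal (\<bar>b x - m a h\<bar> powr q) \<partial>lebesgue)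
        \<le> (\<integral>\<^sup>+ x \<in> cube a h. maximal_commutator b ?f x ennpowr q \<partial>lebesgue)"
    proof (rule nn_integral_mono)
      fix x
      show "ennreal (\<bar>b x - m a h\<bar> powr q) * indicator (cube a h) x \<le> maximal_commutator b ?f x ennpowr q * indicator (cube a h) x"
        using ennpowr_mono[OF pt, of x q] q1 by (cases "x \<in> cube a h") (simp_all add: ennpowr_ennreal)
    qed
    also note M
    also have "W powr q * h powr lam = (C * h powr \<beta>) powr q * h ^ ?n"
    proof -
      \<comment> \<open>This is the relation between \<open>p\<close> and \<open>q\<close>
        multiplied by \<open>(real ?n - lam) * q\<close>.\<close>
      have "(real ?n - lam) / p * q + lam = \<beta> * q + real ?n"
        using q lam p q1 by (simp add: field_simps)
      then have "h powr ((real ?n - lam) / p * q) * h powr lam = h powr (\<beta> * q) * h powr real ?n"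
        by (simp only: powr_add[symmetric])
      then show ?thesis
        using C h by (simp add: W_def powr_mult powr_powr powr_realpow)
    qed
    finally have pow: "(\<integral>\<^sup>+ x \<in> cube a h. ennreal (\<bar>b x - m a h\<bar> powr q) \<partial>lebesgue) \<le> ennreal ((C * h powr \<beta>) powr q * h ^ ?n)" .
    have "(\<integral>\<^sup>+ x \<in> cube a h. ennreal \<bar>b x - m a h\<bar> \<partial>lebesgue) \<le> ennreal (2 * (C * h powr \<beta>) * h ^ ?n)"
      by (rule set_nn_integral_le_of_powr[OF _ _ q1 _ hn(2) emeasure_cube[OF less_imp_le[OF h]] pow])
         (use C borel_measurable_of_locally_integrable[OF b] in \<open>auto intro!: borel_measurable_diff\<close>)
    then show ?thesis by (simp add: mult.assoc)
  qed
  then show ?thesis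
    unfolding m_def by (intro campanato_imp_lipschitz[OF b \<beta>, of "2 * C"]) (use C in auto)
qed

theorem theorem1p2:
  fixes b :: "real ^ 'n \<Rightarrow> real" and \<beta> p q lam :: real
  assumes "locally_integrable b"
    and "0 < \<beta>" "\<beta> < 1"
    and "1 < p" "p < real CARD('n) / \<beta>"
    and "0 < lam" "lam < real CARD('n) - \<beta> * p"
    and "1 / q = 1 / p - \<beta> / (real CARD('n) - lam)"
  shows "b \<in> lipschitz_space \<beta> \<longleftrightarrow> bounded_morrey (maximal_commutator b) p q lam"
proof
  assume "b \<in> lipschitz_space \<beta>"
  with assms show "bounded_morrey (maximal_commutator b) p q lam"
    by (intro lipschitz_maximal_commutator_bounded)
next
  assume "bounded_morrey (maximal_commutator b) p q lam"
  \<comment> \<open>The bound \<open>1 < q\<close> follows from \<open>p < q\<close> and permits the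
    passage from q-th powers to first powers.\<close>
  moreover have "lam < real CARD('n)" "1 < q"
    using sobolev_exponent[OF assms(2,4,7,8)] assms(4) by auto
  ultimately show "b \<in> lipschitz_space \<beta>"
    using assms by (intro bounded_maximal_commutator_imp_lipschitz) auto
qed

end
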